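(* For every sufficiently large $n$ there is a connected graph $G=(V,E)$ with $\Theta(n)$ nodes such that for every source node $s\in V$ (i.e., $S_0=\{s\}$): (1) for the adversarial \textsc{RPull} protocol (with a suitable adaptive adversary), the expected number of rounds until all nodes of $V$ are informed is $\Omega(\sqrt{n})$; (2) with high probability, the random \textsc{RPull} protocol informs all nodes of $V$ within $O(\log^2 n)$ rounds.
   Context: Rumor spreading on a graph $G=(V,E)$ with $n$ nodes proceeds in synchronous rounds; $S_t$ denotes the set of informed nodes after $t$ rounds, starting from the set $S_0$ of initially informed nodes. Restricted pull (\textsc{RPull}): in each round, every uninformed node sends a request to a neighbor chosen uniformly at random (independently); every informed node $v$ that receives a nonempty set $R_v$ of requests in that round selects exactly one node of $R_v$, which then learns the rumor (other requests at $v$ are not served). In the adversarial \textsc{RPull} protocol, the selected node in $R_v$ is chosen by an adaptive adversary; in the random \textsc{RPull} protocol it is chosen uniformly at random from $R_v$, independently for different nodes and rounds. "With high probability" means with probability at least $1-n^{-c}$ for some constant $c\ge 1$. *)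

theory Defs
  imports "HOL-Probability.Probability"
begin

definition simple_graph :: "nat set \<Rightarrow> (nat \<Rightarrow> nat \<Rightarrow> bool) \<Rightarrow> bool" where
  "simple_graph V E \<longleftrightarrow> finite V \<and> (\<forall>u w. E u w \<longrightarrow> u \<in> V \<and> w \<in> V)
     \<and> (\<forall>u w. E u w \<longrightarrow> E w u) \<and> (\<forall>u. \<not> E u u)"

definition connected_graph :: "nat set \<Rightarrow> (nat \<Rightarrow> nat \<Rightarrow> bool) \<Rightarrow> bool" where
  "connected_graph V E \<longleftrightarrow> simple_graph V E \<and> V \<noteq> {} \<and> (\<forall>u\<in>V. \<forall>w\<in>V. E\<^sup>*\<^sup>* u w)"

definition nbrs :: "(nat \<Rightarrow> nat \<Rightarrow> bool) \<Rightarrow> nat \<Rightarrow> nat set" where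
  "nbrs E u = {w. E u w}"

definition requests :: "nat set \<Rightarrow> (nat \<Rightarrow> nat \<Rightarrow> bool) \<Rightarrow> nat set \<Rightarrow> (nat \<Rightarrow> nat) pmf" where
  "requests V E S = Pi_pmf (V - S) 0 (\<lambda>u. pmf_of_set (nbrs E u))"

definition req_set :: "nat set \<Rightarrow> nat set \<Rightarrow> (nat \<Rightarrow> nat) \<Rightarrow> nat \<Rightarrow> nat set" where
  "req_set V S f v = {u \<in> V - S. f u = v}"

definition served :: "nat set \<Rightarrow> nat set \<Rightarrow> (nat \<Rightarrow> nat) \<Rightarrow> nat set" where
  "served V S f = {v \<in> S. req_set V S f v \<noteq> {}}"

definition rand_rpull_step :: "nat set \<Rightarrow> (nat \<Rightarrow> nat \<Rightarrow> bool) \<Rightarrow> nat set \<Rightarrow> nat set pmf" where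
  "rand_rpull_step V E S =
     bind_pmf (requests V E S) (\<lambda>f.
       map_pmf (\<lambda>g. S \<union> g ` served V S f)
         (Pi_pmf (served V S f) 0 (\<lambda>v. pmf_of_set (req_set V S f v))))"

fun rand_rpull :: "nat set \<Rightarrow> (nat \<Rightarrow> nat \<Rightarrow> bool) \<Rightarrow> nat set \<Rightarrow> nat \<Rightarrow> nat set pmf" where
  "rand_rpull V E S0 0 = return_pmf S0"
| "rand_rpull V E S0 (Suc t) = bind_pmf (rand_rpull V E S0 t) (rand_rpull_step V E)"

(* ---------- adversarial RPull ----------
   An adaptive adversary sees the whole history [S_0,...,S_t] of informed sets
   and the requests f of the current round, and chooses for each informed v
   which requester adv h f v in R_v is served. *)
type_synonym adversary = "nat set list \<Rightarrow> (nat \<Rightarrow> nat) \<Rightarrow> nat \<Rightarrow> nat"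

definition valid_adversary :: "nat set \<Rightarrow> adversary \<Rightarrow> bool" where
  "valid_adversary V adv \<longleftrightarrow>
     (\<forall>h f v. h \<noteq> [] \<longrightarrow> v \<in> served V (last h) f \<longrightarrow> adv h f v \<in> req_set V (last h) f v)"

definition adv_rpull_step :: "nat set \<Rightarrow> (nat \<Rightarrow> nat \<Rightarrow> bool) \<Rightarrow> adversary \<Rightarrow> nat set list \<Rightarrow> nat set list pmf" where
  "adv_rpull_step V E adv h =
     map_pmf (\<lambda>f. h @ [last h \<union> adv h f ` served V (last h) f]) (requests V E (last h))"

fun adv_rpull :: "nat set \<Rightarrow> (nat \<Rightarrow> nat \<Rightarrow> bool) \<Rightarrow> adversary \<Rightarrow> nat set \<Rightarrow> nat \<Rightarrow> nat set list pmf" where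
  "adv_rpull V E adv S0 0 = return_pmf [S0]"
| "adv_rpull V E adv S0 (Suc t) = bind_pmf (adv_rpull V E adv S0 t) (adv_rpull_step V E adv)"

(* Expected number of rounds T = min{t. S_t = V} until all nodes are informed,
   via E[T] = sum_{t>=0} Pr[T > t], and T > t iff S_t \<noteq> V (S_t is monotone). *)
definition adv_expected_time :: "nat set \<Rightarrow> (nat \<Rightarrow> nat \<Rightarrow> bool) \<Rightarrow> adversary \<Rightarrow> nat set \<Rightarrow> ennreal" where
  "adv_expected_time V E adv S0 =
     (\<Sum>t. ennreal (measure_pmf.prob (adv_rpull V E adv S0 t) {h. last h \<noteq> V}))"

end

theory Submission
  imports Defs
begin

text \<open>
  Let \<open>M\<close> be about \<open>sqrt n\<close>. A hub is adjacent to the root of a binary tree that leads to a clique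
  on \<open>M\<^sup>2\<close> nodes, and to \<open>M\<close> decoys. Each decoy has degree about \<open>M / (4 log M)\<close>, so that about \<open>log M\<close>
  decoys call the hub per round. An adversary that lets the hub prefer decoys needs about \<open>M\<close> rounds to
  exhaust them, whereas a random choice serves the root with probability of order \<open>1 / log M\<close> per
  round. The remaining neighbours of a decoy lie in a private blob; from a blob the rumor enters the
  clique only through a clique node, which calls the blob with probability \<open>1 / M\<^sup>2\<close>, so this bypass does
  not help within \<open>M\<close> rounds. Conversely, the root of a blob calls its clique node with constant probability, so in the
  random protocol everything is informed soon after the clique. So that every source reaches the
  hub quickly, each blob is linked to a leaf of a tree feeding the hub, through a cap of degree above
  \<open>M\<close>, hence in the opposite direction this link is used rarely. Two copies, joined at the roots of
  these trees, provide for every source a copy that does not contain it.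

  For the adversary, the potential that is \<open>1\<close> once the clique part is hit, and otherwise twice
  the fraction of hit blobs (capped at \<open>1\<close>), has drift at most \<open>6 / M\<close>.
\<close>

section \<open>Restricted pull on finite graphs\<close>

text \<open>An uninformed \<open>u\<close> is served by an informed neighbor \<open>v\<close> in a
  round with probability at least \<open>1 / (deg u * (1 + load S v))\<close>, where the load is the
  expected number of calls at \<open>v\<close>. So an edge between a node of low and a node of high
  degree is almost a one-way link: fast towards the low degree if the load is moderate, slow towards
  the high degree. A node of high degree still learns quickly once a constant fraction of its
  neighbors is informed and lightly loaded; hence caps and decoys sit on leaves of trees, whose
  nodes have degree at most 3. The decoy degree \<open>k + 1\<close> is squeezed from two sides.
  With \<open>M / 2\<close> decoys left, all of them miss the hub with probability at most
  \<open>exp (- M / (2 * (k + 1)))\<close>, which is below \<open>1 / M\<close> if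
  \<open>k + 1\<close> is at most \<open>M / (2 * a)\<close>; the random protocol pays the factor
  \<open>M / (k + 1)\<close>, at most \<open>4 * a\<close>, at the hub. This factor, the depth of
  the trees and the number of growth steps in the clique are all of order \<open>a\<close>, and so
  is the number of repetitions that makes a failure polynomially small; the product is the
  \<open>a^2\<close> of the bound. Capping the potential at 1 makes the drift bound hold in every
  state, so nothing has to be conditioned on.\<close>

lemma prob_bind_pmf:
  "measure_pmf.prob (bind_pmf p q) X = (\<integral>x. measure_pmf.prob (q x) X \<partial>measure_pmf p)"
proof -
  have int: "integrable (measure_pmf p) (\<lambda>x. measure_pmf.prob (q x) X)"
    by (rule measure_pmf.integrable_const_bound[where B=1]) auto
  have "ennreal (measure_pmf.prob (bind_pmf p q) X) = (\<integral>\<^sup>+x. ennreal (measure_pmf.prob (q x) X) \<partial>measure_pmf p)"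
    by (simp flip: measure_pmf.emeasure_eq_measure)
  also have "\<dots> = ennreal (\<integral>x. measure_pmf.prob (q x) X \<partial>measure_pmf p)"
    using int by (intro nn_integral_eq_integral) auto
  finally show ?thesis by simp
qed

text \<open>Union bound over two phases: either the first ends in the bad set \<open>B\<close>, or
  the second fails on its own.\<close>

lemma prob_bind_pmf_le:
  assumes "\<And>x. x \<in> set_pmf p \<Longrightarrow> x \<notin> B \<Longrightarrow> measure_pmf.prob (q x) X \<le> d" "0 \<le> d"
  shows "measure_pmf.prob (bind_pmf p q) X \<le> measure_pmf.prob p B + d"
proof -
  have "(\<integral>x. measure_pmf.prob (q x) X \<partial>measure_pmf p) \<le> (\<integral>x. indicator B x + d \<partial>measure_pmf p)"
  proof (rule integral_mono_AE)
    show "integrable (measure_pmf p) (\<lambda>x. measure_pmf.prob (q x) X)"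
      by (rule measure_pmf.integrable_const_bound[where B=1]) auto
    show "integrable (measure_pmf p) (\<lambda>x. indicator B x + d)"
      by (rule measure_pmf.integrable_const_bound[where B="1+d"])
         (use assms(2) in \<open>auto simp: indicator_def\<close>)
    show "AE x in measure_pmf p. measure_pmf.prob (q x) X \<le> indicator B x + d"
      using assms by (auto simp: AE_measure_pmf_iff indicator_def intro: order_trans[OF measure_pmf.prob_le_1])
  qed
  also have "\<dots> = measure_pmf.prob p B + d"
    by (subst Bochner_Integration.integral_add) (auto intro: measure_pmf.integrable_const_bound[where B=1] simp: indicator_def)
  finally show ?thesis by (simp add: prob_bind_pmf)
qed

section \<open>Monotone predicates on informed sets\<close>

lemma mono_mem: "mono (\<lambda>S. x \<in> S)"
  by (auto simp: mono_def)

lemma mono_ball: "(\<And>x. x \<in> X \<Longrightarrow> mono (P x)) \<Longrightarrow> mono (\<lambda>S. \<forall>x\<in>X. P x S)"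
  by (auto simp: mono_def)

lemma mono_all: "(\<And>x. mono (P x)) \<Longrightarrow> mono (\<lambda>S. \<forall>x. P x S)"
  by (auto simp: mono_def)

lemma mono_bex: "(\<And>x. x \<in> X \<Longrightarrow> mono (P x)) \<Longrightarrow> mono (\<lambda>S. \<exists>x\<in>X. P x S)"
  by (auto simp: mono_def)

lemma mono_conj: "mono P \<Longrightarrow> mono Q \<Longrightarrow> mono (\<lambda>S. P S \<and> Q S)"
  by (auto simp: mono_def)

lemmas mono_state = mono_mem mono_ball mono_all mono_bex mono_conj

locale rpull =
  fixes V :: "nat set" and E :: "nat \<Rightarrow> nat \<Rightarrow> bool"
  assumes simple: "simple_graph V E"
    and nbrs_nonempty: "\<And>u. u \<in> V \<Longrightarrow> nbrs E u \<noteq> {}"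
begin

definition deg :: "nat \<Rightarrow> nat" where
  "deg u = card (nbrs E u)"

text \<open>The expected number of calls that arrive at \<open>v\<close> in a round starting from
  \<open>S\<close>.\<close>

definition load :: "nat set \<Rightarrow> nat \<Rightarrow> real" where
  "load S v = (\<Sum>w \<in> {w \<in> V - S. E w v}. 1 / real (deg w))"

lemma finite_V [simp]: "finite V"
  and E_in_V: "E u w \<Longrightarrow> u \<in> V \<and> w \<in> V"
  and E_sym: "E u w \<Longrightarrow> E w u"
  using simple by (auto simp: simple_graph_def)

lemma nbrs_subset: "nbrs E u \<subseteq> V"
  using E_in_V by (auto simp: nbrs_def)

lemma finite_nbrs [simp]: "finite (nbrs E u)"
  using nbrs_subset finite_V by (rule finite_subset)

lemma deg_pos: "u \<in> V \<Longrightarrow> deg u > 0"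
  using nbrs_nonempty by (auto simp: deg_def card_gt_0_iff)

lemma load_nonneg: "load S v \<ge> 0"
  by (auto simp: load_def intro!: sum_nonneg)

lemma load_le:
  assumes "finite D" "{w \<in> V - S. E w v} \<subseteq> D"
  shows "load S v \<le> (\<Sum>w\<in>D. 1 / real (deg w))"
  unfolding load_def by (rule sum_mono2) (use assms in auto)

lemma load_le_deg: "load S v \<le> real (deg v)"
proof -
  have "load S v \<le> (\<Sum>w\<in>nbrs E v. 1 / real (deg w))"
    using E_sym by (intro load_le finite_nbrs) (auto simp: nbrs_def)
  also have "\<dots> \<le> (\<Sum>w\<in>nbrs E v. 1)"
    by (intro sum_mono) (auto simp: divide_simps)
  finally show ?thesis by (simp add: deg_def)
qed

section \<open>The probabilities of a single round\<close>

lemma requests_prob: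
  assumes "U \<subseteq> V - S"
  shows "measure_pmf.prob (requests V E S) {f. \<forall>u\<in>U. f u \<in> B u}
    = (\<Prod>u\<in>U. real (card (nbrs E u \<inter> B u)) / real (deg u))"
proof -
  have "{f. \<forall>u\<in>U. f u \<in> B u} = Pi (V - S) (\<lambda>u. if u \<in> U then B u else UNIV)"
    using assms by (auto simp: Pi_def)
  then have "measure_pmf.prob (requests V E S) {f. \<forall>u\<in>U. f u \<in> B u}
      = (\<Prod>u\<in>V - S. measure_pmf.prob (pmf_of_set (nbrs E u)) (if u \<in> U then B u else UNIV))"
    by (simp add: requests_def measure_Pi_pmf_Pi)
  also have "\<dots> = (\<Prod>u\<in>U. measure_pmf.prob (pmf_of_set (nbrs E u)) (B u))"
    by (rule prod.mono_neutral_cong_right) (use assms in auto)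
  also have "\<dots> = (\<Prod>u\<in>U. real (card (nbrs E u \<inter> B u)) / real (deg u))"
    by (rule prod.cong) (use assms nbrs_nonempty in \<open>auto simp: measure_pmf_of_set deg_def\<close>)
  finally show ?thesis .
qed

lemma requests_prob1:
  assumes "u \<in> V - S" "E u v"
  shows "measure_pmf.prob (requests V E S) {f. f u = v} = 1 / real (deg u)"
proof -
  have "nbrs E u \<inter> {v} = {v}" using assms by (auto simp: nbrs_def)
  then show ?thesis
    using requests_prob[of "{u}" S "\<lambda>_. {v}"] assms by simp
qed

lemma requests_prob2:
  assumes "u \<in> V - S" "E u v" "w \<in> V - S" "w \<noteq> u"
  shows "measure_pmf.prob (requests V E S) {f. f u = v \<and> f w = v}
    = 1 / real (deg u) * (if E w v then 1 / real (deg w) else 0)"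
proof -
  have "nbrs E u \<inter> {v} = {v}" "nbrs E w \<inter> {v} = (if E w v then {v} else {})"
    using assms by (auto simp: nbrs_def)
  then show ?thesis
    using requests_prob[of "{u,w}" S "\<lambda>_. {v}"] assms by auto
qed

text \<open>Finite support makes every real function of the calls integrable, whatever its
  form.\<close>

lemma finite_set_requests: "finite (set_pmf (requests V E S))"
proof -
  have "finite (PiE_dflt (V - S) 0 (set_pmf \<circ> (\<lambda>u. pmf_of_set (nbrs E u))))"
    by (rule finite_PiE_dflt) (use nbrs_nonempty in auto)
  then show ?thesis
    unfolding requests_def using set_Pi_pmf_subset' finite_subset finite_V finite_Diff by metis
qed

lemma set_requests:
  assumes "f \<in> set_pmf (requests V E S)" "u \<in> V - S"
  shows "E u (f u)"
proof -
  have "f u \<in> set_pmf (pmf_of_set (nbrs E u))"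
    using assms set_Pi_pmf_subset'[of "V - S" 0 "\<lambda>u. pmf_of_set (nbrs E u)"]
    by (auto simp: requests_def PiE_dflt_def)
  then have "f u \<in> nbrs E u" using assms nbrs_nonempty[of u] by simp
  then show ?thesis by (simp add: nbrs_def)
qed

text \<open>The next informed set forgets who served whom. The bounds are therefore proved for the
  joint law of calls \<open>f\<close> and answers \<open>g\<close>, and
  \<open>rand_rpull_step_round\<close> projects them.\<close>

definition round :: "nat set \<Rightarrow> ((nat \<Rightarrow> nat) \<times> (nat \<Rightarrow> nat)) pmf" where
  "round S = bind_pmf (requests V E S) (\<lambda>f. map_pmf (Pair f)
     (Pi_pmf (served V S f) 0 (\<lambda>v. pmf_of_set (req_set V S f v))))"

lemma rand_rpull_step_round:
  "rand_rpull_step V E S = map_pmf (\<lambda>(f, g). S \<union> g ` served V S f) (round S)"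
  by (simp add: rand_rpull_step_def round_def map_bind_pmf map_pmf_comp)

definition serve :: "nat \<Rightarrow> nat \<Rightarrow> ((nat \<Rightarrow> nat) \<times> (nat \<Rightarrow> nat)) set" where
  "serve u v = {(f, g). f u = v \<and> g v = u}"

lemma finite_req_set [simp]: "finite (req_set V S f v)"
  by (auto simp: req_set_def)

lemma finite_served: "S \<subseteq> V \<Longrightarrow> finite (served V S f)"
  by (rule finite_subset[of _ V]) (auto simp: served_def)

text \<open>The call \<open>f u = v\<close> makes \<open>v\<close> a served node, so
  \<open>g v\<close> is an actual answer and not the default value of the product.\<close>

lemma serve_informs:
  assumes "u \<in> V - S" "v \<in> S" "(f, g) \<in> serve u v"
  shows "u \<in> g ` served V S f"
  using assms by (force simp: serve_def served_def req_set_def)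

text \<open>Conditioned on \<open>u\<close> calling \<open>v\<close>, node \<open>u\<close> is served with probability \<open>1 / (1 + x)\<close>, where
  \<open>x\<close> counts the competing calls; the tangent of \<open>1 / (1 + x)\<close> at the load reduces the bound to
  pairwise independence.\<close>

lemma serve_prob:
  assumes "S \<subseteq> V" "u \<in> V - S" "v \<in> S" "E u v"
  shows "measure_pmf.prob (round S) (serve u v) \<ge> 1 / (real (deg u) * (1 + load S v))"
proof -
  define m where "m = load S v"
  define W where "W = V - S - {u}"
  have m: "m \<ge> 0" by (simp add: m_def load_nonneg)
  have finW: "finite W" by (simp add: W_def)
  define F :: "(nat \<Rightarrow> nat) \<Rightarrow> real" where
    "F f = indicator {f. f u = v} f * ((1 + 2 * m) / (1 + m)^2)
       - (\<Sum>w\<in>W. indicator {f. f u = v \<and> f w = v} f) / (1 + m)^2" for f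
  have tangent: "1 / (1 + x) \<ge> (1 + 2 * m) / (1 + m)^2 - x / (1 + m)^2" if "x \<ge> 0" for x :: real
  proof -
    \<comment> \<open>The right side exceeds the left side by \<open>(x - m)^2\<close>.\<close>
    have "(1 + 2 * m - x) * (1 + x) \<le> (1 + m)^2"
      using zero_le_power2[of "x - m"] by (simp add: power2_eq_square algebra_simps)
    then show ?thesis using that m by (simp add: divide_simps)
  qed
  have pointwise: "F f \<le> measure_pmf.prob (map_pmf (Pair f)
      (Pi_pmf (served V S f) 0 (\<lambda>v. pmf_of_set (req_set V S f v)))) (serve u v)" for f
  proof (cases "f u = v")
    case False
    then show ?thesis by (simp add: F_def)
  next
    case True
    let ?P = "Pi_pmf (served V S f) 0 (\<lambda>v. pmf_of_set (req_set V S f v))"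
    have v: "v \<in> served V S f" and u: "u \<in> req_set V S f v"
      using assms True by (auto simp: served_def req_set_def)
    have "measure_pmf.prob (map_pmf (Pair f) ?P) (serve u v) = measure_pmf.prob ?P ((\<lambda>g. g v) -` {u})"
      using True by (simp add: serve_def vimage_def)
    also have "\<dots> = measure_pmf.prob (map_pmf (\<lambda>g. g v) ?P) {u}"
      by simp
    also have "\<dots> = pmf (pmf_of_set (req_set V S f v)) u"
      using v assms(1) by (subst Pi_pmf_component) (auto simp: finite_served measure_pmf_single)
    also have "\<dots> = 1 / real (card (req_set V S f v))"
      using u by (subst pmf_of_set) auto
    finally have p: "measure_pmf.prob (map_pmf (Pair f) ?P) (serve u v) = 1 / real (card (req_set V S f v))" .
    have "req_set V S f v = insert u {w \<in> W. f w = v}"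
      using u by (auto simp: W_def req_set_def)
    then have "card (req_set V S f v) = Suc (card {w \<in> W. f w = v})"
      using finW by (simp add: W_def)
    moreover have "real (card {w \<in> W. f w = v}) = (\<Sum>w\<in>W. indicator {f. f u = v \<and> f w = v} f)"
      using True finW by (simp add: indicator_def sum.If_cases Int_def)
    ultimately have "F f = (1 + 2 * m) / (1 + m)^2 - real (card {w \<in> W. f w = v}) / (1 + m)^2"
      "measure_pmf.prob (map_pmf (Pair f) ?P) (serve u v) = 1 / (1 + real (card {w \<in> W. f w = v}))"
      using True p by (simp_all add: F_def)
    then show ?thesis using tangent by simp
  qed
  have int: "integrable (measure_pmf (requests V E S)) h" for h :: "_ \<Rightarrow> real"
    by (rule integrable_measure_pmf_finite[OF finite_set_requests])
  \<comment> \<open>The competitors exclude \<open>u\<close>, whereas the load counts it; replacing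
    one by the other only weakens the bound.\<close>
  have sumW: "(\<Sum>w\<in>W. if E w v then 1 / real (deg w) else 0) \<le> m"
  proof -
    have "(\<Sum>w\<in>W. if E w v then 1 / real (deg w) else 0) = (\<Sum>w\<in>{w\<in>W. E w v}. 1 / real (deg w))"
      using finW by (simp add: sum.If_cases Int_def)
    also have "\<dots> \<le> m"
      unfolding m_def load_def by (rule sum_mono2) (auto simp: W_def)
    finally show ?thesis .
  qed
  have "(\<integral>f. F f \<partial>measure_pmf (requests V E S))
      = measure_pmf.prob (requests V E S) {f. f u = v} * ((1 + 2 * m) / (1 + m)^2)
        - (\<Sum>w\<in>W. measure_pmf.prob (requests V E S) {f. f u = v \<and> f w = v}) / (1 + m)^2"
    unfolding F_def by (simp add: int Bochner_Integration.integral_diff Bochner_Integration.integral_sum)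
  also have "\<dots> = 1 / real (deg u) * ((1 + 2 * m) / (1 + m)^2
        - (\<Sum>w\<in>W. if E w v then 1 / real (deg w) else 0) / (1 + m)^2)"
    using assms by (simp add: requests_prob1 requests_prob2 W_def sum_distrib_left[symmetric] right_diff_distrib'
        del: mult_if_delta times_divide_eq_right times_divide_eq_left) (simp add: sum_distrib_left[symmetric] algebra_simps)
  also have "\<dots> \<ge> 1 / real (deg u) * ((1 + 2 * m) / (1 + m)^2 - m / (1 + m)^2)"
    using sumW by (intro mult_left_mono diff_left_mono divide_right_mono) auto
  finally have "(\<integral>f. F f \<partial>measure_pmf (requests V E S)) \<ge> 1 / real (deg u) * ((1 + 2 * m) / (1 + m)^2 - m / (1 + m)^2)" .
  moreover have "(1 + 2 * m) / (1 + m)^2 - m / (1 + m)^2 = 1 / (1 + m)"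
    using m by (simp add: divide_simps power2_eq_square)
  moreover have "(\<integral>f. F f \<partial>measure_pmf (requests V E S)) \<le> measure_pmf.prob (round S) (serve u v)"
    unfolding round_def prob_bind_pmf by (intro integral_mono int pointwise)
  ultimately show ?thesis by (simp add: m_def mult.commute)
qed

lemma set_rand_rpull_step:
  assumes "S \<subseteq> V" "S' \<in> set_pmf (rand_rpull_step V E S)"
  shows "S \<subseteq> S'" "S' \<subseteq> V" "\<And>u. u \<in> S' - S \<Longrightarrow> \<exists>v\<in>S. E u v"
proof -
  obtain f g where f: "f \<in> set_pmf (requests V E S)"
    and g: "g \<in> set_pmf (Pi_pmf (served V S f) 0 (\<lambda>v. pmf_of_set (req_set V S f v)))"
    and S': "S' = S \<union> g ` served V S f"
    using assms by (auto simp: rand_rpull_step_def)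
  have *: "g v \<in> req_set V S f v" if "v \<in> served V S f" for v
  proof -
    have "g v \<in> set_pmf (pmf_of_set (req_set V S f v))"
      using that g set_Pi_pmf_subset'[of "served V S f" 0] assms(1)
      by (auto simp: PiE_dflt_def finite_served)
    then show ?thesis using that by (subst (asm) set_pmf_of_set) (auto simp: served_def)
  qed
  show "S \<subseteq> S'" using S' by auto
  show "S' \<subseteq> V" using S' * assms by (auto simp: req_set_def)
  fix u assume "u \<in> S' - S"
  then obtain v where v: "v \<in> served V S f" "u = g v" using S' by auto
  then have "u \<in> V - S" "f u = v" using * by (auto simp: req_set_def)
  then show "\<exists>v\<in>S. E u v" using set_requests[OF f, of u] v by (auto simp: served_def)
qed

text \<open>Since \<open>v\<close> answers one call only, the events that it serves different
  \<open>u\<close> are disjoint, and the bounds of \<open>serve_prob\<close> add up.\<close>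

lemma push_prob:
  assumes "S \<subseteq> V" "U \<subseteq> V - S" "v \<in> S" "\<And>u. u \<in> U \<Longrightarrow> E u v"
    and "\<And>u. u \<in> U \<Longrightarrow> deg u \<le> d" and "load S v \<le> l" and "d > 0"
  shows "measure_pmf.prob (rand_rpull_step V E S) {S'. S' \<inter> U \<noteq> {}} \<ge> real (card U) / (real d * (1 + l))"
proof -
  have fin: "finite U" using assms(2) finite_V by (meson finite_Diff finite_subset)
  have l: "load S v \<ge> 0" by (rule load_nonneg)
  have "real (card U) / (real d * (1 + l)) = (\<Sum>u\<in>U. 1 / (real d * (1 + l)))" by simp
  also have "\<dots> \<le> (\<Sum>u\<in>U. measure_pmf.prob (round S) (serve u v))"
  proof (rule sum_mono)
    fix u assume u: "u \<in> U"
    have "1 / (real d * (1 + l)) \<le> 1 / (real (deg u) * (1 + load S v))"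
      using assms u l deg_pos[of u] by (intro divide_left_mono mult_mono mult_pos_pos) auto
    also have "\<dots> \<le> measure_pmf.prob (round S) (serve u v)"
      using assms u by (intro serve_prob) auto
    finally show "1 / (real d * (1 + l)) \<le> measure_pmf.prob (round S) (serve u v)" .
  qed
  also have "\<dots> = measure_pmf.prob (round S) (\<Union>u\<in>U. serve u v)"
    by (rule measure_pmf.finite_measure_finite_Union[symmetric])
       (use fin in \<open>auto simp: disjoint_family_on_def serve_def\<close>)
  also have "\<dots> \<le> measure_pmf.prob (round S) ((\<lambda>(f, g). S \<union> g ` served V S f) -` {S'. S' \<inter> U \<noteq> {}})"
    by (intro measure_pmf.finite_measure_mono) (use assms serve_informs[of _ S v] in \<open>auto, blast\<close>)
  finally show ?thesis by (simp add: rand_rpull_step_round)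
qed

text \<open>Dual to \<open>push_prob\<close>: \<open>u\<close> places one call only, so the events
  for different \<open>v\<close> are disjoint. Many informed neighbors thus compensate for a large
  degree of \<open>u\<close>.\<close>

lemma pull_prob:
  assumes "S \<subseteq> V" "u \<in> V - S" "A \<subseteq> S" "\<And>v. v \<in> A \<Longrightarrow> E u v"
    and "deg u \<le> d" and "\<And>v. v \<in> A \<Longrightarrow> load S v \<le> l"
  shows "measure_pmf.prob (rand_rpull_step V E S) {S'. u \<in> S'} \<ge> real (card A) / (real d * (1 + l))"
proof (cases "A = {}")
  case False
  have fin: "finite A" using assms(1,3) finite_V by (meson finite_subset)
  have "real (card A) / (real d * (1 + l)) = (\<Sum>v\<in>A. 1 / (real d * (1 + l)))" by simp
  also have "\<dots> \<le> (\<Sum>v\<in>A. measure_pmf.prob (round S) (serve u v))"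
  proof (rule sum_mono)
    fix v assume v: "v \<in> A"
    have "1 / (real d * (1 + l)) \<le> 1 / (real (deg u) * (1 + load S v))"
      using assms v load_nonneg[of S v] deg_pos[of u]
      by (intro divide_left_mono mult_mono mult_pos_pos) (auto intro!: add_pos_nonneg order_trans[of 0 "load S v" l])
    also have "\<dots> \<le> measure_pmf.prob (round S) (serve u v)"
      using assms v by (intro serve_prob) auto
    finally show "1 / (real d * (1 + l)) \<le> measure_pmf.prob (round S) (serve u v)" .
  qed
  also have "\<dots> = measure_pmf.prob (round S) (\<Union>v\<in>A. serve u v)"
    by (rule measure_pmf.finite_measure_finite_Union[symmetric])
       (use fin in \<open>auto simp: disjoint_family_on_def serve_def\<close>)
  also have "\<dots> \<le> measure_pmf.prob (round S) ((\<lambda>(f, g). S \<union> g ` served V S f) -` {S'. u \<in> S'})"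
    by (intro measure_pmf.finite_measure_mono) (use assms in \<open>auto dest: subsetD intro: serve_informs\<close>)
  finally show ?thesis by (simp add: rand_rpull_step_round)
qed simp

text \<open>A node answers at most one call, so the number of newly informed nodes is at most
  \<open>card X\<close>, and a large mean forces a large value with positive probability (reverse Markov).\<close>

lemma growth_prob:
  assumes "S \<subseteq> V" "U \<subseteq> V - S" "X \<subseteq> S" "X \<noteq> {}" "\<And>u v. u \<in> U \<Longrightarrow> v \<in> X \<Longrightarrow> E u v"
    and "\<And>u. u \<in> U \<Longrightarrow> deg u \<le> d" and "\<And>v. v \<in> X \<Longrightarrow> load S v \<le> l"
    and "real (card U) / (real d * (1 + l)) \<ge> 2 * e" and "e \<ge> 0"
  shows "measure_pmf.prob (rand_rpull_step V E S) {S'. real (card (S' \<inter> U)) \<ge> e * real (card X)} \<ge> e"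
proof -
  have finU: "finite U" and finX: "finite X"
    using assms(1-3) finite_V by (meson finite_Diff finite_subset)+
  have X: "card X > 0" using assms(4) finX by (simp add: card_gt_0_iff)
  \<comment> \<open>\<open>Y\<close> counts serving pairs. It is at most \<open>card X\<close>
    because each \<open>v\<close> answers once (\<open>YX\<close>), and at most the number of
    informed nodes of \<open>U\<close> after the round because each \<open>u\<close> calls once
    (\<open>YU\<close>).\<close>
  define Y :: "_ \<Rightarrow> real" where "Y h = (\<Sum>u\<in>U. \<Sum>v\<in>X. indicator (serve u v) h)" for h
  have Y0: "Y h \<ge> 0" for h by (auto simp: Y_def intro!: sum_nonneg)
  have YX: "Y h \<le> real (card X)" for h
  proof -
    have "Y h = (\<Sum>v\<in>X. \<Sum>u\<in>U. indicator (serve u v) h)"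
      unfolding Y_def by (rule sum.swap)
    also have "\<dots> \<le> (\<Sum>v\<in>X. 1)"
    proof (rule sum_mono)
      fix v
      have "(\<Sum>u\<in>U. indicator (serve u v) h) \<le> (\<Sum>u\<in>U. if u = snd h v then 1 else (0::real))"
        by (rule sum_mono) (auto simp: indicator_def serve_def)
      also have "\<dots> \<le> 1" using finU by simp
      finally show "(\<Sum>u\<in>U. indicator (serve u v) h) \<le> (1::real)" .
    qed
    finally show ?thesis by simp
  qed
  have YU: "Y (f, g) \<le> real (card ((S \<union> g ` served V S f) \<inter> U))" for f g
  proof -
    have "Y (f, g) \<le> (\<Sum>u\<in>U. if u \<in> S \<union> g ` served V S f then 1 else 0)"
      unfolding Y_def
    proof (rule sum_mono)
      fix u assume u: "u \<in> U"
      show "(\<Sum>v\<in>X. indicator (serve u v) (f, g)) \<le> (if u \<in> S \<union> g ` served V S f then 1 else (0::real))"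
      proof (cases "u \<in> S \<union> g ` served V S f")
        case True
        have "(\<Sum>v\<in>X. indicator (serve u v) (f, g)) \<le> (\<Sum>v\<in>X. if v = f u then 1 else (0::real))"
          by (rule sum_mono) (auto simp: indicator_def serve_def)
        also have "\<dots> \<le> 1" using finX by simp
        finally show ?thesis using True by simp
      next
        case False
        have "(\<Sum>v\<in>X. indicator (serve u v) (f, g)) = (0::real)"
        proof (rule sum.neutral, rule ballI)
          fix v assume "v \<in> X"
          then have "(f, g) \<notin> serve u v"
            using serve_informs[of u S v f g] False u assms(2,3) by auto
          then show "indicator (serve u v) (f, g) = (0::real)" by simp
        qed
        then show ?thesis using False by simp
      qed
    qed
    also have "\<dots> = real (card ((S \<union> g ` served V S f) \<inter> U))"
      using finU by (simp add: sum.If_cases Int_def conj_commute)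
    finally show ?thesis .
  qed
  have bnd: "integrable (measure_pmf (round S)) h" if "\<And>x. \<bar>h x\<bar> \<le> B" for h :: "_ \<Rightarrow> real" and B
    using that by (intro measure_pmf.integrable_const_bound[where B=B]) auto
  have "2 * e * real (card X) \<le> real (card U) / (real d * (1 + l)) * real (card X)"
    using assms(8) by (intro mult_right_mono) auto
  also have "\<dots> = (\<Sum>u\<in>U. \<Sum>v\<in>X. 1 / (real d * (1 + l)))" by simp
  also have "\<dots> \<le> (\<Sum>u\<in>U. \<Sum>v\<in>X. measure_pmf.prob (round S) (serve u v))"
  proof (intro sum_mono)
    fix u v assume uv: "u \<in> U" "v \<in> X"
    have "1 / (real d * (1 + l)) \<le> 1 / (real (deg u) * (1 + load S v))"
      using assms uv load_nonneg[of S v] deg_pos[of u]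
      by (intro divide_left_mono mult_mono mult_pos_pos) (auto intro!: add_pos_nonneg order_trans[of 0 "load S v" l])
    also have "\<dots> \<le> measure_pmf.prob (round S) (serve u v)"
      using assms uv by (intro serve_prob) auto
    finally show "1 / (real d * (1 + l)) \<le> measure_pmf.prob (round S) (serve u v)" .
  qed
  also have "\<dots> = (\<integral>h. Y h \<partial>measure_pmf (round S))"
    unfolding Y_def
    by (subst Bochner_Integration.integral_sum; (subst Bochner_Integration.integral_sum)?)
       (auto intro!: bnd[where B=1] Bochner_Integration.integrable_sum simp: indicator_def)
  \<comment> \<open>On the event that \<open>Y\<close> is large it is bounded by
    \<open>card X\<close>, off the event by the threshold itself.\<close>
  also have "\<dots> \<le> (\<integral>h. real (card X) * indicator {h. Y h \<ge> e * real (card X)} h + e * real (card X) \<partial>measure_pmf (round S))"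
  proof (rule integral_mono)
    show "integrable (measure_pmf (round S)) Y"
      by (rule bnd[where B="real (card X)"]) (use Y0 YX in auto)
    show "integrable (measure_pmf (round S)) (\<lambda>h. real (card X) * indicator {h. Y h \<ge> e * real (card X)} h + e * real (card X))"
      by (rule bnd[where B="real (card X) + \<bar>e * real (card X)\<bar>"]) (auto simp: indicator_def)
    fix h
    show "Y h \<le> real (card X) * indicator {h. Y h \<ge> e * real (card X)} h + e * real (card X)"
    proof (cases "Y h \<ge> e * real (card X)")
      case True
      have "0 \<le> e * real (card X)" using assms(9) by simp
      then show ?thesis using True YX[of h] by auto
    qed auto
  qed
  also have "\<dots> = real (card X) * measure_pmf.prob (round S) {h. Y h \<ge> e * real (card X)} + e * real (card X)"
  proof -
    have "integrable (measure_pmf (round S)) (\<lambda>h. indicator {h. Y h \<ge> e * real (card X)} h :: real)"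
      by (rule bnd[where B=1]) (auto simp: indicator_def)
    then show ?thesis by (subst Bochner_Integration.integral_add) auto
  qed
  finally have "e * real (card X) \<le> measure_pmf.prob (round S) {h. Y h \<ge> e * real (card X)} * real (card X)"
    by (simp add: algebra_simps)
  then have "e \<le> measure_pmf.prob (round S) {h. Y h \<ge> e * real (card X)}"
    using X by simp
  also have "\<dots> \<le> measure_pmf.prob (round S) ((\<lambda>(f, g). S \<union> g ` served V S f) -` {S'. real (card (S' \<inter> U)) \<ge> e * real (card X)})"
    by (intro measure_pmf.finite_measure_mono) (use YU in \<open>auto intro: order_trans\<close>)
  finally show ?thesis by (simp add: rand_rpull_step_round)
qed

section \<open>A calculus of reachability over several rounds\<close>

lemma rand_rpull_add:
  "rand_rpull V E S (t + t') = bind_pmf (rand_rpull V E S t) (\<lambda>S'. rand_rpull V E S' t')"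
  by (induction t') (simp_all add: bind_return_pmf' bind_assoc_pmf)

lemma set_rand_rpull:
  assumes "S \<subseteq> V" "S' \<in> set_pmf (rand_rpull V E S t)"
  shows "S \<subseteq> S' \<and> S' \<subseteq> V"
  using assms(2)
proof (induction t arbitrary: S')
  case (Suc t)
  then obtain S'' where "S'' \<in> set_pmf (rand_rpull V E S t)" "S' \<in> set_pmf (rand_rpull_step V E S'')"
    by auto
  then show ?case using Suc.IH[of S''] set_rand_rpull_step[of S'' S'] by blast
qed (use assms(1) in auto)

text \<open>The rumor travels along edges only. Hence a positive probability of informing all nodes
  proves connectedness, and no paths have to be exhibited.\<close>

lemma set_rand_rpull_connected:
  assumes "s \<in> V" "S \<in> set_pmf (rand_rpull V E {s} t)" "u \<in> S"
  shows "E\<^sup>*\<^sup>* s u"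
  using assms(2,3)
proof (induction t arbitrary: S u)
  case (Suc t)
  then obtain S' where S': "S' \<in> set_pmf (rand_rpull V E {s} t)" "S \<in> set_pmf (rand_rpull_step V E S')"
    by auto
  show ?case
  proof (cases "u \<in> S'")
    case False
    then obtain v where "v \<in> S'" "E u v"
      using Suc.prems S' set_rand_rpull_step(3)[of S' S u] set_rand_rpull[of "{s}" S' t] assms(1) by auto
    then show ?thesis using Suc.IH[OF S'(1)] E_sym by (metis rtranclp.rtrancl_into_rtrancl)
  qed (use Suc.IH S' in auto)
qed auto

text \<open>A Hoare triple with duration \<open>t\<close> and failure probability \<open>d\<close>.
  Quantifying over all starting sets that satisfy \<open>Q\<close> lets triples be composed by the
  Markov property.\<close>

definition reach :: "nat \<Rightarrow> real \<Rightarrow> (nat set \<Rightarrow> bool) \<Rightarrow> (nat set \<Rightarrow> bool) \<Rightarrow> bool" where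
  "reach t d Q R \<longleftrightarrow> (\<forall>S\<subseteq>V. Q S \<longrightarrow> measure_pmf.prob (rand_rpull V E S t) {S'. \<not> R S'} \<le> d)"

lemma reachD: "reach t d Q R \<Longrightarrow> S \<subseteq> V \<Longrightarrow> Q S \<Longrightarrow> measure_pmf.prob (rand_rpull V E S t) {S'. \<not> R S'} \<le> d"
  by (simp add: reach_def)

lemma reach_trans:
  assumes "reach t1 d1 P Q" "reach t2 d2 Q R" "0 \<le> d2"
  shows "reach (t1 + t2) (d1 + d2) P R"
  unfolding reach_def
proof (intro allI impI)
  fix S assume S: "S \<subseteq> V" "P S"
  have "measure_pmf.prob (rand_rpull V E S (t1 + t2)) {S'. \<not> R S'}
      \<le> measure_pmf.prob (rand_rpull V E S t1) {S'. \<not> Q S'} + d2"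
    unfolding rand_rpull_add
    by (rule prob_bind_pmf_le) (use assms reachD[OF assms(2)] set_rand_rpull[OF S(1)] in auto)
  also have "\<dots> \<le> d1 + d2" using reachD[OF assms(1) S] by simp
  finally show "measure_pmf.prob (rand_rpull V E S (t1 + t2)) {S'. \<not> R S'} \<le> d1 + d2" .
qed

text \<open>Informed sets only grow, so a monotone predicate is never lost again; this is why all
  state predicates below are monotone.\<close>

lemma reach_refl:
  assumes "mono Q"
  shows "reach t 0 Q Q"
  unfolding reach_def
proof (intro allI impI)
  fix S assume S: "S \<subseteq> V" "Q S"
  have "S' \<notin> {S'. \<not> Q S'}" if "S' \<in> set_pmf (rand_rpull V E S t)" for S'
    using set_rand_rpull[OF S(1) that] S(2) assms by (auto simp: mono_def)
  then have "measure_pmf.prob (rand_rpull V E S t) {S'. \<not> Q S'} = 0"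
    by (subst measure_pmf_zero_iff) auto
  then show "measure_pmf.prob (rand_rpull V E S t) {S'. \<not> Q S'} \<le> 0" by simp
qed

lemma reach_weaken:
  assumes "reach t d Q R" "\<And>S. S \<subseteq> V \<Longrightarrow> Q' S \<Longrightarrow> Q S" "\<And>S. S \<subseteq> V \<Longrightarrow> R S \<Longrightarrow> R' S" "d \<le> d'"
  shows "reach t d' Q' R'"
  unfolding reach_def
proof (intro allI impI)
  fix S assume S: "S \<subseteq> V" "Q' S"
  have "measure_pmf.prob (rand_rpull V E S t) {S'. \<not> R' S'} \<le> measure_pmf.prob (rand_rpull V E S t) {S'. \<not> R S'}"
    by (rule measure_pmf.finite_measure_mono_AE)
       (use assms(3) set_rand_rpull[OF S(1)] in \<open>auto simp: AE_measure_pmf_iff\<close>)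
  also have "\<dots> \<le> d" using assms S by (auto simp: reach_def)
  finally show "measure_pmf.prob (rand_rpull V E S t) {S'. \<not> R' S'} \<le> d'" using assms(4) by simp
qed

lemma reach_mono_time:
  assumes "reach t d Q R" "mono R" "t \<le> t'"
  shows "reach t' d Q R"
  using reach_trans[OF assms(1) reach_refl[OF assms(2), of "t' - t"]] assms(3) by simp

lemma reach_all:
  assumes "finite X" "\<And>x. x \<in> X \<Longrightarrow> reach t d Q (R x)"
  shows "reach t (real (card X) * d) Q (\<lambda>S. \<forall>x\<in>X. R x S)"
  unfolding reach_def
proof (intro allI impI)
  fix S assume S: "S \<subseteq> V" "Q S"
  have "measure_pmf.prob (rand_rpull V E S t) {S'. \<not> (\<forall>x\<in>X. R x S')}
      = measure_pmf.prob (rand_rpull V E S t) (\<Union>x\<in>X. {S'. \<not> R x S'})"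
    by (rule arg_cong[where f="measure_pmf.prob _"]) auto
  also have "\<dots> \<le> (\<Sum>x\<in>X. measure_pmf.prob (rand_rpull V E S t) {S'. \<not> R x S'})"
    by (rule measure_pmf.finite_measure_subadditive_finite) (use assms in auto)
  also have "\<dots> \<le> (\<Sum>x\<in>X. d)"
    by (rule sum_mono) (use assms S in \<open>auto simp: reach_def\<close>)
  finally show "measure_pmf.prob (rand_rpull V E S t) {S'. \<not> (\<forall>x\<in>X. R x S')} \<le> real (card X) * d"
    by simp
qed

lemma reach_conj:
  assumes "reach t d Q R" "reach t d' Q R'"
  shows "reach t (d + d') Q (\<lambda>S. R S \<and> R' S)"
  unfolding reach_def
proof (intro allI impI)
  fix S assume S: "S \<subseteq> V" "Q S"
  have "measure_pmf.prob (rand_rpull V E S t) {S'. \<not> (R S' \<and> R' S')}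
      = measure_pmf.prob (rand_rpull V E S t) ({S'. \<not> R S'} \<union> {S'. \<not> R' S'})"
    by (rule arg_cong[where f="measure_pmf.prob _"]) auto
  also have "\<dots> \<le> measure_pmf.prob (rand_rpull V E S t) {S'. \<not> R S'} + measure_pmf.prob (rand_rpull V E S t) {S'. \<not> R' S'}"
    by (rule measure_Un_le) auto
  also have "\<dots> \<le> d + d'" using assms S by (auto simp: reach_def intro!: add_mono)
  finally show "measure_pmf.prob (rand_rpull V E S t) {S'. \<not> (R S' \<and> R' S')} \<le> d + d'" .
qed

lemma reach_keep:
  assumes "reach t d Q R" "mono Q"
  shows "reach t d Q (\<lambda>S. Q S \<and> R S)"
  using reach_conj[OF reach_refl[OF assms(2)] assms(1)] by simp

lemma reach_chain:
  assumes "\<And>j. j < m \<Longrightarrow> reach t d (Q j) (Q (Suc j))" "0 \<le> d" "mono (Q 0)"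
  shows "reach (m * t) (real m * d) (Q 0) (Q m)"
  using assms(1)
proof (induction m)
  case 0
  show ?case using reach_refl[OF assms(3), of 0] by simp
next
  case (Suc m)
  have "reach (m * t) (real m * d) (Q 0) (Q m)" using Suc by simp
  then have "reach (m * t + t) (real m * d + d) (Q 0) (Q (Suc m))"
    by (rule reach_trans) (use Suc.prems assms(2) in auto)
  then show ?case by (simp add: algebra_simps)
qed

text \<open>Geometric waiting: monotonicity keeps \<open>Q\<close> available in each round and makes
  \<open>R\<close> absorbing, so failure decays like \<open>(1 - p) ^ t\<close>.\<close>

lemma reach_wait:
  assumes "mono Q" "mono R" "0 \<le> p" "p \<le> 1"
    and step: "\<And>S. S \<subseteq> V \<Longrightarrow> Q S \<Longrightarrow> \<not> R S \<Longrightarrow> measure_pmf.prob (rand_rpull_step V E S) {S'. R S'} \<ge> p"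
  shows "reach t (exp (- (p * real t))) Q R"
  unfolding reach_def
proof (intro allI impI)
  fix S assume S: "S \<subseteq> V" "Q S"
  have *: "measure_pmf.prob (rand_rpull V E S t) {S'. \<not> R S'} \<le> (1 - p) ^ t"
  proof (induction t)
    case (Suc t)
    have "measure_pmf.prob (rand_rpull V E S (Suc t)) {S'. \<not> R S'}
       = (\<integral>x. measure_pmf.prob (rand_rpull_step V E x) {S'. \<not> R S'} \<partial>measure_pmf (rand_rpull V E S t))"
      by (simp add: prob_bind_pmf)
    also have "\<dots> \<le> (\<integral>x. (1 - p) * indicator {S'. \<not> R S'} x \<partial>measure_pmf (rand_rpull V E S t))"
    proof (rule integral_mono_AE)
      show "integrable (measure_pmf (rand_rpull V E S t)) (\<lambda>x. measure_pmf.prob (rand_rpull_step V E x) {S'. \<not> R S'})"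
        by (rule measure_pmf.integrable_const_bound[where B=1]) auto
      show "integrable (measure_pmf (rand_rpull V E S t)) (\<lambda>x. (1 - p) * indicator {S'. \<not> R S'} x)"
        by (rule measure_pmf.integrable_const_bound[where B=1]) (use assms in \<open>auto simp: indicator_def\<close>)
      have "measure_pmf.prob (rand_rpull_step V E x) {S'. \<not> R S'} \<le> (1 - p) * indicator {S'. \<not> R S'} x"
        if x: "x \<in> set_pmf (rand_rpull V E S t)" for x
      proof -
        have xV: "S \<subseteq> x" "x \<subseteq> V" using set_rand_rpull[OF S(1) x] by auto
        show ?thesis
        proof (cases "R x")
          case True
          then have "measure_pmf.prob (rand_rpull_step V E x) {S'. \<not> R S'} = 0"
            using monoD[OF assms(2) set_rand_rpull_step(1)[OF xV(2)]] by (subst measure_pmf_zero_iff) auto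
          then show ?thesis using True by simp
        next
          case False
          have "Q x" using S xV assms(1) by (auto simp: mono_def)
          then have "p \<le> measure_pmf.prob (rand_rpull_step V E x) {S'. R S'}"
            using step xV False by blast
          moreover have "measure_pmf.prob (rand_rpull_step V E x) {S'. \<not> R S'}
              = 1 - measure_pmf.prob (rand_rpull_step V E x) {S'. R S'}"
            by (subst measure_pmf.prob_compl[symmetric]) (auto intro: arg_cong[where f="measure_pmf.prob _"])
          ultimately show ?thesis using False by simp
        qed
      qed
      then show "AE x in measure_pmf (rand_rpull V E S t).
          measure_pmf.prob (rand_rpull_step V E x) {S'. \<not> R S'} \<le> (1 - p) * indicator {S'. \<not> R S'} x"
        by (simp add: AE_measure_pmf_iff)
    qed
    also have "\<dots> = (1 - p) * measure_pmf.prob (rand_rpull V E S t) {S'. \<not> R S'}" by simp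
    also have "\<dots> \<le> (1 - p) * (1 - p) ^ t" using Suc assms by (intro mult_left_mono) auto
    finally show ?case by simp
  qed auto
  also have "(1 - p) ^ t \<le> exp (- p) ^ t"
    using assms exp_ge_add_one_self[of "- p"] by (intro power_mono) auto
  also have "\<dots> = exp (- (p * real t))" by (simp add: exp_of_nat_mult[symmetric] mult.commute)
  finally show "measure_pmf.prob (rand_rpull V E S t) {S'. \<not> R S'} \<le> exp (- (p * real t))" .
qed

end

section \<open>The graph\<close>

text \<open>The Boolean selects one of two copies. \<open>Tr c i j\<close> is node \<open>j\<close>, in heap order starting at \<open>1\<close>,
  of the \<open>i\<close>-th binary tree: \<open>i < M\<close> for the blob of the \<open>i\<close>-th decoy, \<open>i = M\<close> for the tree feeding
  the hub, \<open>i = M + 1\<close> for the tree feeding the clique. \<open>Cap c i\<close> sees all leaves of the \<open>i\<close>-th tree,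
  and \<open>Cap c M\<close> is the hub; \<open>Dec\<close> are the decoys and \<open>Cl\<close> the clique nodes.\<close>

datatype node = Tr bool nat nat | Cap bool nat | Dec bool nat | Cl bool nat

instance node :: countable
  by countable_datatype

abbreviation enc :: "node \<Rightarrow> nat" where
  "enc \<equiv> to_nat"

locale gadget =
  fixes a :: nat
  assumes a_ge: "4 \<le> a"
begin

definition M :: nat where "M = 2 ^ a"
definition N :: nat where "N = M ^ 2"
text \<open>The number of blob neighbors of a decoy. Up to constant factors its size is forced by
  \<open>M_div_k\<close> and \<open>k_upper\<close>.\<close>

definition k :: nat where "k = M div (4 * a)"
text \<open>The number of leaves. It is a power of two, so the heap indices from \<open>sz i\<close>
  to \<open>2 * sz i - 1\<close> are exactly the leaves and form one level.\<close>

definition sz :: "nat \<Rightarrow> nat" where "sz i = (if i \<le> M then M else N)"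

text \<open>Each tree node spends one edge on its parent, or at the root on an outside link, and at
  most two on children, or at a leaf on outside links. This keeps all tree degrees at most
  3.\<close>

fun nb :: "node \<Rightarrow> node set" where
  "nb (Tr c i j) =
     (if j \<ge> 2 then {Tr c i (j div 2)}
      else if i < M then {Cl c i} else if i = M then {Tr (\<not> c) M 1} else {Cap c M})
     \<union> (if j < sz i then {Tr c i (2 * j), Tr c i (2 * j + 1)}
        else {Cap c i} \<union> (if i < M \<and> j < M + k then {Dec c i} else if i = M then {Cap c (j - M)} else {}))"
| "nb (Cap c i) = Tr c i ` {sz i..<2 * sz i}
     \<union> (if i < M then {Tr c M (M + i)}
        else if i = M then Dec c ` {..<M} \<union> {Tr c (M + 1) 1} else Cl c ` {..<N})"
| "nb (Dec c i) = insert (Cap c M) (Tr c i ` {M..<M + k})"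
| "nb (Cl c j) = Cl c ` ({..<N} - {j}) \<union> {Cap c (M + 1)} \<union> (if j < M then {Tr c j 1} else {})"

fun is_node :: "node \<Rightarrow> bool" where
  "is_node (Tr c i j) \<longleftrightarrow> i \<le> M + 1 \<and> 1 \<le> j \<and> j < 2 * sz i"
| "is_node (Cap c i) \<longleftrightarrow> i \<le> M + 1"
| "is_node (Dec c i) \<longleftrightarrow> i < M"
| "is_node (Cl c j) \<longleftrightarrow> j < N"

definition V :: "nat set" where
  "V = enc ` Collect is_node"

text \<open>Testing \<open>x\<close> suffices, because \<open>nb_is_node\<close> supplies the same
  for \<open>y\<close>.\<close>

definition E :: "nat \<Rightarrow> nat \<Rightarrow> bool" where
  "E u w \<longleftrightarrow> (\<exists>x y. u = enc x \<and> w = enc y \<and> is_node x \<and> y \<in> nb x)"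

lemma exp_ge: "4 * a \<le> M"
proof -
  have "4 * n \<le> 2 ^ n" if "n \<ge> 4" for n :: nat
    using that by (induction n rule: dec_induct) auto
  then show ?thesis using a_ge by (simp add: M_def)
qed

lemma M_ge: "16 \<le> M"
  using exp_ge a_ge by linarith

lemma M_le_N: "16 * M \<le> N"
  using M_ge by (simp add: N_def power2_eq_square)

lemma N_ge: "256 \<le> N"
  using M_le_N M_ge by linarith

lemma k_pos: "k \<ge> 1"
  using exp_ge a_ge by (simp add: k_def div_greater_zero_iff Suc_leI)

lemma k_le: "k \<le> M"
  by (simp add: k_def)

text \<open>Limits the contention of all decoys at the hub, for the random protocol.\<close>

lemma M_div_k: "real M / real (k + 1) \<le> 4 * real a"
proof -
  have "M < 4 * a * (k + 1)"
    using a_ge by (simp add: k_def) (metis add.commute dividend_less_times_div mult_Suc_right mult_pos_pos zero_less_numeral not_numeral_le_zero gr0I)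
  then have "real M < 4 * real a * real (k + 1)"
    by (metis of_nat_less_iff of_nat_mult of_nat_numeral)
  then show ?thesis by (simp add: divide_simps)
qed

text \<open>The opposite constraint, for the adversary: half of the decoys still produce at least
  \<open>a\<close> expected calls at the hub.\<close>

lemma k_upper: "real (k + 1) \<le> real M / (2 * real a)"
proof -
  have "4 * a * k \<le> M" by (simp add: k_def)
  then have "4 * a * (k + 1) \<le> 2 * M" using exp_ge by (simp add: algebra_simps)
  then have "4 * real a * real (k + 1) \<le> 2 * real M"
    by (metis of_nat_le_iff of_nat_mult of_nat_numeral)
  then show ?thesis using a_ge by (simp add: field_simps)
qed

lemma sz_ge: "16 \<le> sz i"
  using M_ge N_ge by (simp add: sz_def)

lemma sz_simps [simp]: "i \<le> M \<Longrightarrow> sz i = M" "sz (Suc M) = N"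
  by (simp_all add: sz_def)

lemma nb_is_node:
  assumes "is_node x" "y \<in> nb x"
  shows "is_node y"
proof (cases x)
  case (Tr c i j)
  then have *: "i \<le> M + 1" "1 \<le> j" "j < 2 * sz i" using assms by auto
  have "j div 2 < 2 * sz i" using * by linarith
  moreover have "j - M \<le> M + 1" if "i = M" using that * by simp
  ultimately show ?thesis using assms * Tr M_ge M_le_N by (auto split: if_splits)
next
  case (Cap c i)
  then show ?thesis using assms M_ge N_ge sz_ge[of i] by (auto split: if_splits)
next
  case (Dec c i)
  then show ?thesis using assms M_ge k_le by auto
next
  case (Cl c j)
  then show ?thesis using assms M_ge by (auto split: if_splits)
qed

lemma nb_sym:
  assumes "is_node x" "y \<in> nb x"
  shows "x \<in> nb y"
proof (cases x)
  case (Tr c i j)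
  then have *: "i \<le> M + 1" "1 \<le> j" "j < 2 * sz i" using assms by auto
  have d: "j = 2 * (j div 2) \<or> j = Suc (2 * (j div 2))" by linarith
  have "j div 2 < sz i" "i \<noteq> M \<Longrightarrow> \<not> i < M \<Longrightarrow> i = Suc M" using * by linarith+
  then show ?thesis using assms * Tr d M_ge N_ge k_le sz_ge[of i] by (auto split: if_splits)
next
  case (Cap c i)
  then show ?thesis using assms M_ge N_ge sz_ge[of i] by (auto split: if_splits)
next
  case (Dec c i)
  then show ?thesis using assms M_ge k_le by auto
next
  case (Cl c j)
  then show ?thesis using assms M_ge by (auto split: if_splits)
qed

lemma nb_irrefl:
  assumes "is_node x" shows "x \<notin> nb x"
  using assms by (cases x) (auto split: if_splits)

lemma finite_nb [simp]: "finite (nb x)"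
  by (cases x) auto

lemma nb_nonempty: "nb x \<noteq> {}"
proof (cases x)
  case (Cap c i)
  then show ?thesis using sz_ge[of i] by auto
qed auto

lemma E_enc [simp]: "E (enc x) (enc y) \<longleftrightarrow> is_node x \<and> y \<in> nb x"
  by (auto simp: E_def)

lemma enc_V [simp]: "enc x \<in> V \<longleftrightarrow> is_node x"
  by (auto simp: V_def)

lemma nbrs_enc: "is_node x \<Longrightarrow> nbrs E (enc x) = enc ` nb x"
  by (auto simp: nbrs_def E_def)

text \<open>Full index boxes that overcount the nodes; since \<open>M ^ 2 = N\<close>, even the
  \<open>M + 1\<close> small trees contribute only a multiple of \<open>N\<close>.\<close>

definition nodes_bound :: "node set" where
  "nodes_bound = (\<lambda>(c, i, j). Tr c i j) ` (UNIV \<times> {..M} \<times> {..<2 * M})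
     \<union> (\<lambda>(c, j). Tr c (M + 1) j) ` (UNIV \<times> {..<2 * N})
     \<union> (\<lambda>(c, i). Cap c i) ` (UNIV \<times> {..M + 1})
     \<union> (\<lambda>(c, i). Dec c i) ` (UNIV \<times> {..<M})
     \<union> (\<lambda>(c, j). Cl c j) ` (UNIV \<times> {..<N})"

lemma is_node_bound: "Collect is_node \<subseteq> nodes_bound"
proof
  fix x assume "x \<in> Collect is_node"
  then show "x \<in> nodes_bound"
    unfolding nodes_bound_def by (cases x) (auto simp: sz_def image_iff split: if_splits)
qed

lemma finite_nodes_bound: "finite nodes_bound"
  by (simp add: nodes_bound_def)

lemma finite_nodes: "finite (Collect is_node)"
  using is_node_bound finite_nodes_bound by (rule finite_subset)

lemma card_V: "card V = card (Collect is_node)"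
  unfolding V_def by (rule card_image) (simp add: inj_on_def)

lemma card_V_upper: "card V \<le> 20 * N"
proof -
  have "card nodes_bound \<le> 2 * ((M + 1) * (2 * M)) + 2 * (2 * N) + 2 * (M + 2) + 2 * M + 2 * N"
    unfolding nodes_bound_def
    by (intro order_trans[OF card_Un_le] add_mono order_trans[OF card_image_le])
       (auto simp: card_cartesian_product)
  also have "(M + 1) * (2 * M) = 2 * N + 2 * M" by (simp add: N_def power2_eq_square)
  also have "2 * (2 * N + 2 * M) + 2 * (2 * N) + 2 * (M + 2) + 2 * M + 2 * N \<le> 20 * N"
    using M_le_N M_ge unfolding distrib_left by linarith
  finally show ?thesis
    using card_mono[OF finite_nodes_bound is_node_bound] card_V by simp
qed

lemma card_V_lower: "N \<le> card V"
proof -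
  have "card (Cl True ` {..<N}) \<le> card (Collect is_node)"
    by (rule card_mono[OF finite_nodes]) auto
  also have "card (Cl True ` {..<N}) = N" by (subst card_image) (auto simp: inj_on_def)
  finally show ?thesis using card_V by simp
qed

sublocale rpull V E
proof
  show "simple_graph V E"
    unfolding simple_graph_def
  proof (intro conjI allI impI)
    show "finite V" using finite_nodes by (simp add: V_def)
    fix u w
    show "\<not> E u u" using nb_irrefl by (auto simp: E_def)
    assume "E u w"
    then obtain x y where "u = enc x" "w = enc y" "is_node x" "y \<in> nb x" by (auto simp: E_def)
    then show "u \<in> V" "w \<in> V" "E w u" using nb_is_node[of x y] nb_sym[of x y] by simp_all
  qed
  show "nbrs E u \<noteq> {}" if "u \<in> V" for u
    using that nb_nonempty by (auto simp: V_def nbrs_enc)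
qed

lemma deg_enc: "is_node x \<Longrightarrow> deg (enc x) = card (nb x)"
  by (simp add: deg_def nbrs_enc card_image inj_on_def)

lemma deg_Tr: "is_node (Tr c i j) \<Longrightarrow> deg (enc (Tr c i j)) \<le> 3"
  by (subst deg_enc) (auto simp: card_insert_if)

lemma card_Tr_leaves: "card (Tr c i ` {m..<n}) = n - m"
  by (subst card_image) (auto simp: inj_on_def)

lemma deg_Cap: "i \<le> M + 1 \<Longrightarrow> deg (enc (Cap c i)) \<le> 3 * sz i"
proof -
  assume i: "i \<le> M + 1"
  have c: "card (Dec c ` {..<M}) = M" "card (Cl c ` {..<N}) = N"
    by (subst card_image; auto simp: inj_on_def)+
  show ?thesis
  proof (rule linorder_cases[of i M])
    assume "i < M"
    have "card (nb (Cap c i)) \<le> card (Tr c i ` {sz i..<2 * sz i}) + card {Tr c M (M + i)}"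
      using \<open>i < M\<close> by (simp only: nb.simps if_True) (rule card_Un_le)
    then show ?thesis using i sz_ge[of i] by (subst deg_enc) (auto simp: card_Tr_leaves)
  next
    assume "i = M"
    have "nb (Cap c i) = Tr c i ` {sz i..<2 * sz i} \<union> (Dec c ` {..<M} \<union> {Tr c (M + 1) 1})"
      using \<open>i = M\<close> by simp
    then have "card (nb (Cap c i)) \<le> card (Tr c i ` {sz i..<2 * sz i}) + card (Dec c ` {..<M} \<union> {Tr c (M + 1) 1})"
      by (metis card_Un_le)
    moreover have "card (Dec c ` {..<M} \<union> {Tr c (M + 1) 1}) \<le> M + 1"
      using card_Un_le[of "Dec c ` {..<M}" "{Tr c (M + 1) 1}"] c by simp
    ultimately show ?thesis using i sz_ge[of i] \<open>i = M\<close> by (subst deg_enc) (auto simp: card_Tr_leaves)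
  next
    assume "M < i"
    then have "\<not> i < M" "i \<noteq> M" by auto
    have "card (nb (Cap c i)) \<le> card (Tr c i ` {sz i..<2 * sz i}) + card (Cl c ` {..<N})"
      using \<open>\<not> i < M\<close> \<open>i \<noteq> M\<close> by (simp only: nb.simps if_True if_False) (rule card_Un_le)
    moreover have "i = Suc M" using i \<open>\<not> i < M\<close> \<open>i \<noteq> M\<close> by simp
    ultimately show ?thesis using sz_ge[of i] c by (subst deg_enc) (auto simp: card_Tr_leaves)
  qed
qed

text \<open>This makes the link from the hub tree back into a blob slow: an uninformed cap calls its
  leaf of the hub tree with probability at most \<open>1 / M\<close>.\<close>

lemma deg_Cap_lower: "i < M \<Longrightarrow> M \<le> deg (enc (Cap c i))"
proof -
  assume i: "i < M"
  have "card (Tr c i ` {M..<2 * M}) \<le> card (nb (Cap c i))"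
    by (rule card_mono) (use i in auto)
  then show ?thesis using i by (simp add: deg_enc card_Tr_leaves)
qed

lemma deg_Dec: "i < M \<Longrightarrow> deg (enc (Dec c i)) = k + 1"
  by (subst deg_enc) (auto simp: card_insert_if card_Tr_leaves)

lemma deg_Cl: "j < N \<Longrightarrow> N \<le> deg (enc (Cl c j)) \<and> deg (enc (Cl c j)) \<le> N + 1"
proof -
  assume j: "j < N"
  have "card (Cl c ` ({..<N} - {j})) = N - 1"
    using j by (subst card_image) (auto simp: inj_on_def)
  then have "card (Cl c ` ({..<N} - {j}) \<union> {Cap c (M + 1)}) = N"
    using j by (subst card_Un_disjoint) auto
  then show ?thesis using j by (subst (1 2) deg_enc) (auto simp: card_insert_if)
qed

text \<open>Only uninformed neighbors call, so loads drop once the surroundings of \<open>y\<close>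
  are informed. The later stages rely on this.\<close>

lemma load_enc_le:
  assumes "finite Z" "\<And>z. is_node z \<Longrightarrow> z \<in> nb y \<Longrightarrow> enc z \<notin> S \<Longrightarrow> z \<in> Z" "is_node y"
  shows "load S (enc y) \<le> (\<Sum>z\<in>Z. 1 / real (deg (enc z)))"
proof -
  have "{w \<in> V - S. E w (enc y)} \<subseteq> enc ` Z"
    using assms nb_sym by (auto simp: V_def)
  then have "load S (enc y) \<le> (\<Sum>w\<in>enc ` Z. 1 / real (deg w))"
    using assms(1) by (intro load_le) auto
  also have "\<dots> = (\<Sum>z\<in>Z. 1 / real (deg (enc z)))"
    by (subst sum.reindex) (auto simp: inj_on_def)
  finally show ?thesis .
qed

section \<open>The random protocol\<close>

text \<open>A step that succeeds with probability \<open>1 / 18\<close> per round fails for \<open>T\<close> rounds with probability at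
  most \<open>\<delta>\<close>; \<open>\<tau>\<close> and \<open>\<epsilon>\<close> are the corresponding bounds for a stage consisting of many such steps.\<close>

definition \<delta> :: real where "\<delta> = exp (- (12 * real a))"

text \<open>The factor \<open>M ^ 4\<close> absorbs all union bounds inside a stage, over the nodes
  of a tree level by level or over the clique.\<close>

definition \<epsilon> :: real where "\<epsilon> = real M ^ 4 * \<delta>"

text \<open>Here \<open>216 = 18 * 12\<close>, which gives the exponent in \<open>\<delta>\<close>.
  The rate \<open>1 / 18\<close> is dictated by the clique: reverse Markov halves a mean slightly
  below \<open>1 / 8\<close>.\<close>

definition T :: nat where "T = 216 * a"

text \<open>Room for every stage: a tree takes at most \<open>4 * a * T\<close>, the hub
  \<open>216 * a^2\<close>, and the clique, the longest, \<open>26 * a * T + T\<close>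
  rounds.\<close>

definition \<tau> :: nat where "\<tau> = 10000 * a\<^sup>2"

definition full :: "bool \<Rightarrow> nat \<Rightarrow> nat set \<Rightarrow> bool" where
  "full c i S \<longleftrightarrow> (\<forall>j\<in>{1..<2 * sz i}. enc (Tr c i j) \<in> S)"

definition touched :: "bool \<Rightarrow> nat \<Rightarrow> nat set \<Rightarrow> bool" where
  "touched c i S \<longleftrightarrow> (\<exists>j\<in>{1..<2 * sz i}. enc (Tr c i j) \<in> S)"

definition cfull :: "bool \<Rightarrow> nat set \<Rightarrow> bool" where
  "cfull c S \<longleftrightarrow> (\<forall>j\<in>{..<N}. enc (Cl c j) \<in> S)"

definition ctouched :: "bool \<Rightarrow> nat set \<Rightarrow> bool" where
  "ctouched c S \<longleftrightarrow> (\<exists>j\<in>{..<N}. enc (Cl c j) \<in> S)"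

lemma mono_full: "mono (full c i)" and mono_touched: "mono (touched c i)"
  and mono_cfull: "mono (cfull c)" and mono_ctouched: "mono (ctouched c)"
  unfolding full_def[abs_def] touched_def[abs_def] cfull_def[abs_def] ctouched_def[abs_def]
  by (intro mono_state)+

lemmas mono_intros = mono_state mono_full mono_touched mono_cfull mono_ctouched

lemma \<delta>_pos: "\<delta> > 0" and \<epsilon>_pos: "\<epsilon> > 0"
  using M_ge by (auto simp: \<delta>_def \<epsilon>_def)

lemma T_le_\<tau>: "T \<le> \<tau>"
proof -
  have "216 * a \<le> 10000 * (a * a)" using a_ge by simp
  then show ?thesis by (simp add: T_def \<tau>_def power2_eq_square)
qed

lemma \<delta>_le_\<epsilon>: "real m \<le> real M ^ 4 \<Longrightarrow> real m * \<delta> \<le> \<epsilon>"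
  unfolding \<epsilon>_def using \<delta>_pos by (intro mult_right_mono) auto

lemma reach_wait_T:
  assumes "mono Q" "mono R"
    and "\<And>S. S \<subseteq> V \<Longrightarrow> Q S \<Longrightarrow> \<not> R S \<Longrightarrow> 1 / 18 \<le> measure_pmf.prob (rand_rpull_step V E S) {S'. R S'}"
  shows "reach T \<delta> Q R"
  using reach_wait[of Q R "1 / 18" T] assms by (simp add: T_def \<delta>_def)

lemma reach_wait_\<tau>:
  assumes "mono Q" "mono R"
    and "\<And>S. S \<subseteq> V \<Longrightarrow> Q S \<Longrightarrow> \<not> R S \<Longrightarrow> 1 / 18 \<le> measure_pmf.prob (rand_rpull_step V E S) {S'. R S'}"
  shows "reach \<tau> \<epsilon> Q R"
proof -
  have "reach \<tau> \<delta> Q R"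
    by (rule reach_mono_time[OF reach_wait_T[OF assms] assms(2) T_le_\<tau>])
  then show ?thesis
    by (rule reach_weaken) (use \<delta>_le_\<epsilon>[of 1] M_ge in auto)
qed

lemma inverse_deg_le: "1 / real (deg u) \<le> 1"
  by (simp add: divide_simps)

lemma pull_one:
  assumes "S \<subseteq> V" "is_node x" "enc x \<notin> S" "y \<in> nb x" "enc y \<in> S"
    and "deg (enc x) \<le> d" "load S (enc y) \<le> l" "p \<le> 1 / (real d * (1 + l))"
  shows "p \<le> measure_pmf.prob (rand_rpull_step V E S) {S'. enc x \<in> S'}"
  using pull_prob[of S "enc x" "{enc y}" d l] assms by auto

lemma pull_many:
  assumes "S \<subseteq> V" "is_node x" "enc x \<notin> S" "Y \<subseteq> nb x" "\<And>y. y \<in> Y \<Longrightarrow> enc y \<in> S"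
    and "deg (enc x) \<le> d" "\<And>y. y \<in> Y \<Longrightarrow> load S (enc y) \<le> l" "p \<le> real (card Y) / (real d * (1 + l))"
  shows "p \<le> measure_pmf.prob (rand_rpull_step V E S) {S'. enc x \<in> S'}"
proof -
  have "card (enc ` Y) = card Y" by (rule card_image) (simp add: inj_on_def)
  moreover have "real (card (enc ` Y)) / (real d * (1 + l)) \<le> measure_pmf.prob (rand_rpull_step V E S) {S'. enc x \<in> S'}"
    by (rule pull_prob) (use assms in auto)
  ultimately show ?thesis using assms(8) by simp
qed

lemma push_many:
  assumes "S \<subseteq> V" "is_node y" "enc y \<in> S" "X \<subseteq> nb y" "\<And>x. x \<in> X \<Longrightarrow> enc x \<notin> S"
    and "\<And>x. x \<in> X \<Longrightarrow> deg (enc x) \<le> d" "load S (enc y) \<le> l" "p \<le> real (card X) / (real d * (1 + l))" "d > 0"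
  shows "p \<le> measure_pmf.prob (rand_rpull_step V E S) {S'. \<exists>x\<in>X. enc x \<in> S'}"
proof -
  have "card (enc ` X) = card X" by (rule card_image) (simp add: inj_on_def)
  moreover have "is_node x \<and> y \<in> nb x" if "x \<in> X" for x
    using that assms(2,4) nb_is_node nb_sym by blast
  moreover have "{S'. S' \<inter> enc ` X \<noteq> {}} = {S'. \<exists>x\<in>X. enc x \<in> S'}" by auto
  moreover have "real (card (enc ` X)) / (real d * (1 + l)) \<le> measure_pmf.prob (rand_rpull_step V E S) {S'. S' \<inter> enc ` X \<noteq> {}}"
    by (rule push_prob) (use assms calculation(2) in auto)
  ultimately show ?thesis using assms(8) by simp
qed

lemma load_Tr: "is_node (Tr c i j) \<Longrightarrow> load S (enc (Tr c i j)) \<le> 3"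
  using load_le_deg[of S "enc (Tr c i j)"] deg_Tr[of c i j] by linarith

lemma pull_Tr_Tr:
  assumes "S \<subseteq> V" "is_node (Tr c i j)" "enc (Tr c i j) \<notin> S" "Tr c' i' j' \<in> nb (Tr c i j)"
    "enc (Tr c' i' j') \<in> S"
  shows "1 / 18 \<le> measure_pmf.prob (rand_rpull_step V E S) {S'. enc (Tr c i j) \<in> S'}"
proof -
  have "is_node (Tr c' i' j')" using assms nb_is_node by blast
  then have "load S (enc (Tr c' i' j')) \<le> 3" by (rule load_Tr)
  then show ?thesis
    by (intro pull_one[OF assms deg_Tr[OF assms(2)]]) auto
qed

section \<open>Spread within trees and across their links\<close>

lemma sz_pow: obtains D where "sz i = 2 ^ D" "D \<le> 2 * a"
proof (cases "i \<le> M")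
  case True then show ?thesis using that[of a] by (simp add: M_def)
next
  case False
  then have "sz i = 2 ^ (2 * a)" by (simp add: sz_def N_def M_def power_mult mult.commute)
  then show ?thesis using that[of "2 * a"] by simp
qed

text \<open>The rumor climbs from any informed node to the root, one level per \<open>T\<close>
  rounds, and then fills the tree downwards level by level.\<close>

lemma touched_full:
  assumes i: "i \<le> M + 1"
  shows "reach \<tau> \<epsilon> (touched c i) (full c i)"
proof -
  obtain D where D: "sz i = 2 ^ D" "D \<le> 2 * a" by (rule sz_pow)
  \<comment> \<open>\<open>U m\<close> finds an informed node outside the lowest \<open>m\<close>
    levels; \<open>L m\<close> says that the levels 0 to \<open>m\<close> are completely informed.
    They meet at the root, where \<open>U D\<close> equals \<open>L 0\<close>.\<close>
  define U where "U m S \<longleftrightarrow> (\<exists>j\<in>{1..<2 ^ (D + 1 - m)}. enc (Tr c i j) \<in> S)" for m S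
  define L where "L m S \<longleftrightarrow> (\<forall>j\<in>{1..<2 ^ (m + 1)}. enc (Tr c i j) \<in> S)" for m S
  have monoU: "mono (U m)" for m unfolding U_def[abs_def] by (intro mono_intros)
  have monoL: "mono (L m)" for m unfolding L_def[abs_def] by (intro mono_intros)
  have up: "reach T \<delta> (U m) (U (Suc m))" if m: "m < D" for m
  proof (rule reach_wait_T[OF monoU monoU])
    fix S assume S: "S \<subseteq> V" "U m S" "\<not> U (Suc m) S"
    then obtain j where j: "1 \<le> j" "j < 2 ^ (D + 1 - m)" "enc (Tr c i j) \<in> S" by (auto simp: U_def)
    have e: "(2::nat) ^ (D + 1 - m) = 2 * 2 ^ (D + 1 - Suc m)"
      using m by (simp add: Suc_diff_le flip: power_Suc)
    have two: "(2::nat) \<le> 2 ^ (D + 1 - Suc m)"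
      using m self_le_power[of "2::nat" "D + 1 - Suc m"] by simp
    have j2: "j \<ge> 2"
    proof (rule ccontr)
      assume "\<not> 2 \<le> j"
      then have "j = 1" using j by simp
      then show False using S(3) j(3) two by (auto simp: U_def)
    qed
    have node: "is_node (Tr c i j)" using j S(1) by (auto dest: subsetD)
    have nb: "Tr c i (j div 2) \<in> nb (Tr c i j)" using j2 by simp
    have mem: "j div 2 \<in> {1..<2 ^ (D + 1 - Suc m)}" using j j2 e by auto
    then have "enc (Tr c i (j div 2)) \<notin> S" using S(3) by (auto simp: U_def)
    then have "1 / 18 \<le> measure_pmf.prob (rand_rpull_step V E S) {S'. enc (Tr c i (j div 2)) \<in> S'}"
      using nb_is_node[OF node nb] nb_sym[OF node nb] S(1) j(3) by (intro pull_Tr_Tr) auto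
    also have "\<dots> \<le> measure_pmf.prob (rand_rpull_step V E S) {S'. U (Suc m) S'}"
      using mem by (intro measure_pmf.finite_measure_mono) (auto simp: U_def simp del: atLeastLessThan_iff)
    finally show "1 / 18 \<le> measure_pmf.prob (rand_rpull_step V E S) {S'. U (Suc m) S'}" .
  qed
  have down: "reach T (2 * real N * \<delta>) (L m) (L (Suc m))" if m: "m < D" for m
  proof -
    have le: "(2::nat) ^ (Suc m + 1) \<le> 2 * sz i"
      unfolding D(1) using m power_increasing[of "Suc m" D "2::nat"] by simp
    have "reach T \<delta> (L m) (\<lambda>S. enc (Tr c i j) \<in> S)" if j: "j \<in> {1..<2 ^ (Suc m + 1)}" for j
    proof (rule reach_wait_T[OF monoL mono_mem])
      fix S assume S: "S \<subseteq> V" "L m S" "enc (Tr c i j) \<notin> S"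
      have node: "is_node (Tr c i j)" using j le i by auto
      have "(1::nat) < 2 ^ (m + 1)" by (rule one_less_power) auto
      then have "(1::nat) \<in> {1..<2 ^ (m + 1)}" unfolding atLeastLessThan_iff by blast
      then have j2: "j \<ge> 2" using S(2,3) j by (cases "j = 1") (auto simp: L_def)
      then have "j div 2 \<in> {1..<2 ^ (m + 1)}" using j by auto
      then have "enc (Tr c i (j div 2)) \<in> S" using S(2) by (auto simp: L_def)
      then show "1 / 18 \<le> measure_pmf.prob (rand_rpull_step V E S) {S'. enc (Tr c i j) \<in> S'}"
        using S node j2 by (intro pull_Tr_Tr[where c'=c and i'=i and j'="j div 2"]) auto
    qed
    then have "reach T (real (card {1..<(2::nat) ^ (Suc m + 1)}) * \<delta>) (L m) (L (Suc m))"
      unfolding L_def[of "Suc m"] by (intro reach_all) auto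
    moreover have "real (card {1..<(2::nat) ^ (Suc m + 1)}) \<le> 2 * real N"
    proof -
      have "card {1..<(2::nat) ^ (Suc m + 1)} \<le> 2 * sz i" using le by simp
      also have "\<dots> \<le> 2 * N" using M_le_N by (simp add: sz_def)
      finally show ?thesis by (metis of_nat_le_iff of_nat_mult of_nat_numeral)
    qed
    ultimately show ?thesis
      using \<delta>_pos by (elim reach_weaken) (auto intro!: mult_right_mono)
  qed
  have "reach (D * T) (real D * \<delta>) (U 0) (U D)"
    using up \<delta>_pos monoU by (intro reach_chain) auto
  moreover have "U D = L 0"
  proof -
    have "{1..<2} = {1::nat}" by auto
    then show ?thesis by (simp add: U_def L_def fun_eq_iff)
  qed
  moreover have "reach (D * T) (real D * (2 * real N * \<delta>)) (L 0) (L D)"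
    using down \<delta>_pos monoL by (intro reach_chain) auto
  ultimately have "reach (D * T + D * T) (real D * \<delta> + real D * (2 * real N * \<delta>)) (U 0) (L D)"
    using \<delta>_pos by (intro reach_trans[of _ _ _ "L 0"]) auto
  moreover have "U 0 = touched c i" "L D = full c i"
    using D(1) by (auto simp: U_def L_def touched_def full_def fun_eq_iff)
  ultimately have R: "reach (D * T + D * T) (real D * \<delta> + real D * (2 * real N * \<delta>)) (touched c i) (full c i)" by simp
  have "D * T \<le> 2 * a * T" using D(2) by (rule mult_le_mono1)
  moreover have "4 * a * T \<le> \<tau>" by (simp add: T_def \<tau>_def power2_eq_square)
  ultimately have "D * T + D * T \<le> \<tau>" by linarith
  then have "reach \<tau> (real D * \<delta> + real D * (2 * real N * \<delta>)) (touched c i) (full c i)"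
    using R mono_full by (blast intro: reach_mono_time)
  moreover have "real D * \<delta> + real D * (2 * real N * \<delta>) = real (D * (2 * N + 1)) * \<delta>"
    by (simp add: algebra_simps)
  \<comment> \<open>The left side counts all single waiting steps: \<open>D\<close> upwards, and at
    most \<open>2 * N\<close> on each of \<open>D\<close> levels downwards.\<close>
  moreover have "real (D * (2 * N + 1)) \<le> real M ^ 4"
  proof -
    have "D \<le> M" using D(2) exp_ge by simp
    then have "D * (2 * N + 1) \<le> M * (16 * N)" using N_ge by (intro mult_le_mono) auto
    also have "\<dots> = (16 * M) * N" by simp
    also have "\<dots> \<le> N * N" using M_le_N by (rule mult_le_mono1)
    also have "\<dots> = M ^ 4" by (simp add: N_def power2_eq_square power4_eq_xxxx)
    finally show ?thesis by (metis of_nat_le_iff of_nat_power)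
  qed
  ultimately have "reach \<tau> (real (D * (2 * N + 1)) * \<delta>) (touched c i) (full c i)"
    "real (D * (2 * N + 1)) * \<delta> \<le> \<epsilon>"
    using \<delta>_le_\<epsilon> by metis+
  then show ?thesis by (elim reach_weaken)
qed

text \<open>The leaves make up at least a third of the neighbors of a cap, and each has load at most
  3.\<close>

lemma full_Cap:
  assumes i: "i \<le> M + 1"
  shows "reach \<tau> \<epsilon> (full c i) (\<lambda>S. enc (Cap c i) \<in> S)"
proof (rule reach_wait_\<tau>)
  fix S assume S: "S \<subseteq> V" "full c i S" "enc (Cap c i) \<notin> S"
  show "1 / 18 \<le> measure_pmf.prob (rand_rpull_step V E S) {S'. enc (Cap c i) \<in> S'}"
  proof (rule pull_many[where Y="Tr c i ` {sz i..<2 * sz i}" and d="3 * sz i" and l=3])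
    show "1 / 18 \<le> real (card (Tr c i ` {sz i..<2 * sz i})) / (real (3 * sz i) * (1 + 3))"
      using sz_ge[of i] by (simp add: card_Tr_leaves)
    show "load S (enc y) \<le> 3" if "y \<in> Tr c i ` {sz i..<2 * sz i}" for y
      using that i sz_ge[of i] by (auto intro!: load_Tr)
  qed (use S i deg_Cap sz_ge[of i] in \<open>auto simp: full_def\<close>)
qed (intro mono_intros)+

lemma full_Dec:
  assumes i: "i < M"
  shows "reach \<tau> \<epsilon> (full c i) (\<lambda>S. enc (Dec c i) \<in> S)"
proof (rule reach_wait_\<tau>)
  fix S assume S: "S \<subseteq> V" "full c i S" "enc (Dec c i) \<notin> S"
  show "1 / 18 \<le> measure_pmf.prob (rand_rpull_step V E S) {S'. enc (Dec c i) \<in> S'}"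
  proof (rule pull_many[where Y="Tr c i ` {M..<M + k}" and d="k + 1" and l=3])
    show "1 / 18 \<le> real (card (Tr c i ` {M..<M + k})) / (real (k + 1) * (1 + 3))"
      using k_pos by (simp add: card_Tr_leaves divide_simps)
    show "load S (enc y) \<le> 3" if "y \<in> Tr c i ` {M..<M + k}" for y
      using that i M_ge k_le by (auto intro!: load_Tr)
  qed (use S i deg_Dec M_ge k_le in \<open>auto simp: full_def\<close>)
qed (intro mono_intros)+

text \<open>The fast direction of the one-way link: with its blob informed, the cap can be called
  only by one leaf of the hub tree, which has degree at most 3.\<close>

lemma Cap_touched_hub:
  assumes i: "i < M"
  shows "reach \<tau> \<epsilon> (\<lambda>S. full c i S \<and> enc (Cap c i) \<in> S) (touched c M)"
proof (rule reach_wait_\<tau>)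
  fix S assume S: "S \<subseteq> V" "full c i S \<and> enc (Cap c i) \<in> S" "\<not> touched c M S"
  have node: "is_node (Tr c M (M + i))" using i by simp
  have "load S (enc (Cap c i)) \<le> (\<Sum>z\<in>{Tr c M (M + i)}. 1 / real (deg (enc z)))"
    by (rule load_enc_le) (use S i in \<open>auto simp: full_def\<close>)
  also have "\<dots> \<le> 1" using inverse_deg_le by simp
  finally have l: "load S (enc (Cap c i)) \<le> 1" .
  have "1 / 18 \<le> measure_pmf.prob (rand_rpull_step V E S) {S'. enc (Tr c M (M + i)) \<in> S'}"
    by (rule pull_one[where y="Cap c i" and d=3 and l=1])
       (use S i l deg_Tr[OF node] node in \<open>auto simp: touched_def\<close>)
  also have "\<dots> \<le> measure_pmf.prob (rand_rpull_step V E S) {S'. touched c M S'}"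
    using node by (intro measure_pmf.finite_measure_mono) (auto simp: touched_def)
  finally show "1 / 18 \<le> measure_pmf.prob (rand_rpull_step V E S) {S'. touched c M S'}" .
qed (intro mono_intros)+

text \<open>The only stage whose success probability is not constant: about \<open>4 * a\<close> decoys are expected
  to compete at the hub.\<close>

lemma hub_touched:
  "reach \<tau> \<epsilon> (\<lambda>S. full c M S \<and> enc (Cap c M) \<in> S) (touched c (M + 1))"
proof -
  have "reach (216 * a\<^sup>2) (exp (- (1 / (18 * real a) * real (216 * a\<^sup>2))))
     (\<lambda>S. full c M S \<and> enc (Cap c M) \<in> S) (touched c (M + 1))"
  proof (rule reach_wait)
    fix S assume S: "S \<subseteq> V" "full c M S \<and> enc (Cap c M) \<in> S" "\<not> touched c (M + 1) S"
    have node: "is_node (Tr c (M + 1) 1)" using N_ge by simp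
    have "load S (enc (Cap c M)) \<le> (\<Sum>z\<in>insert (Tr c (M + 1) 1) (Dec c ` {..<M}). 1 / real (deg (enc z)))"
      by (rule load_enc_le) (use S in \<open>auto simp: full_def\<close>)
    also have "\<dots> = 1 / real (deg (enc (Tr c (M + 1) 1))) + (\<Sum>i<M. 1 / real (deg (enc (Dec c i))))"
      by (subst sum.insert) (auto simp: sum.reindex inj_on_def)
    also have "\<dots> = 1 / real (deg (enc (Tr c (M + 1) 1))) + real M / real (k + 1)"
      by (simp add: deg_Dec)
    also have "\<dots> \<le> 1 + 4 * real a" using inverse_deg_le M_div_k by (intro add_mono)
    finally have l: "load S (enc (Cap c M)) \<le> 1 + 4 * real a" .
    have "1 / (18 * real a) \<le> measure_pmf.prob (rand_rpull_step V E S) {S'. enc (Tr c (M + 1) 1) \<in> S'}"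
    proof (rule pull_one[where y="Cap c M" and d=3])
      show "1 / (18 * real a) \<le> 1 / (real 3 * (1 + (1 + 4 * real a)))"
        using a_ge by (intro divide_left_mono) auto
    qed (use S l deg_Tr[OF node] N_ge in \<open>auto simp: touched_def\<close>)
    also have "\<dots> \<le> measure_pmf.prob (rand_rpull_step V E S) {S'. touched c (M + 1) S'}"
      using node by (intro measure_pmf.finite_measure_mono) (auto simp: touched_def)
    finally show "1 / (18 * real a) \<le> measure_pmf.prob (rand_rpull_step V E S) {S'. touched c (M + 1) S'}" .
  qed (use a_ge in \<open>auto intro!: mono_intros\<close>)
  moreover have "exp (- (1 / (18 * real a) * real (216 * a\<^sup>2))) = \<delta>"
    using a_ge by (simp add: \<delta>_def power2_eq_square)
  ultimately have "reach \<tau> \<delta> (\<lambda>S. full c M S \<and> enc (Cap c M) \<in> S) (touched c (M + 1))"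
    using reach_mono_time[of "216 * a\<^sup>2" \<delta> _ "touched c (M + 1)" \<tau>] mono_touched by (simp add: \<tau>_def)
  then show ?thesis
    by (rule reach_weaken) (use \<delta>_le_\<epsilon>[of 1] M_ge in auto)
qed

lemma card_Cl: "card (Cl c ` X) = card X"
  by (rule card_image) (simp add: inj_on_def)

lemma sum_Cl_le: "X \<subseteq> {..<N} \<Longrightarrow> (\<Sum>z\<in>Cl c ` X. 1 / real (deg (enc z))) \<le> 1"
proof -
  assume X: "X \<subseteq> {..<N}"
  have "(\<Sum>z\<in>Cl c ` X. 1 / real (deg (enc z))) \<le> (\<Sum>z\<in>Cl c ` X. 1 / real N)"
  proof (rule sum_mono)
    fix z assume "z \<in> Cl c ` X"
    then have "N \<le> deg (enc z)" using X deg_Cl by auto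
    then show "1 / real (deg (enc z)) \<le> 1 / real N" using N_ge by (intro divide_left_mono) auto
  qed
  also have "\<dots> = real (card X) / real N" by (simp add: card_Cl)
  also have "\<dots> \<le> 1" using card_mono[OF _ X] N_ge by (simp add: divide_simps)
  finally show ?thesis .
qed

text \<open>The \<open>N\<close> clique nodes together send about one call per round to the cap, and
  nothing else competes with them.\<close>

lemma Cap_ctouched:
  "reach \<tau> \<epsilon> (\<lambda>S. full c (M + 1) S \<and> enc (Cap c (M + 1)) \<in> S) (ctouched c)"
proof (rule reach_wait_\<tau>)
  fix S assume S: "S \<subseteq> V" "full c (M + 1) S \<and> enc (Cap c (M + 1)) \<in> S" "\<not> ctouched c S"
  have "load S (enc (Cap c (M + 1))) \<le> (\<Sum>z\<in>Cl c ` {..<N}. 1 / real (deg (enc z)))"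
    by (rule load_enc_le) (use S N_ge in \<open>auto simp: full_def\<close>)
  also have "\<dots> \<le> 1" by (rule sum_Cl_le) simp
  finally have l: "load S (enc (Cap c (M + 1))) \<le> 1" .
  have "1 / 18 \<le> measure_pmf.prob (rand_rpull_step V E S) {S'. \<exists>x\<in>Cl c ` {..<N}. enc x \<in> S'}"
  proof (rule push_many[where d="N + 1" and l=1])
    show "1 / 18 \<le> real (card (Cl c ` {..<N})) / (real (N + 1) * (1 + 1))"
      using N_ge by (simp add: card_Cl divide_simps)
  qed (use S l deg_Cl in \<open>auto simp: ctouched_def\<close>)
  also have "\<dots> \<le> measure_pmf.prob (rand_rpull_step V E S) {S'. ctouched c S'}"
    by (intro measure_pmf.finite_measure_mono) (auto simp: ctouched_def)
  finally show "1 / 18 \<le> measure_pmf.prob (rand_rpull_step V E S) {S'. ctouched c S'}" .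
qed (intro mono_intros)+

text \<open>Once the clique is informed, only its cap and the blob root can still call this clique
  node.\<close>

lemma cfull_touched:
  assumes i: "i < M"
  shows "reach \<tau> \<epsilon> (cfull c) (touched c i)"
proof (rule reach_wait_\<tau>)
  fix S assume S: "S \<subseteq> V" "cfull c S" "\<not> touched c i S"
  have node: "is_node (Tr c i 1)" and iN: "i < N" using i M_ge M_le_N by auto
  have "load S (enc (Cl c i)) \<le> (\<Sum>z\<in>{Cap c (M + 1), Tr c i 1}. 1 / real (deg (enc z)))"
    by (rule load_enc_le) (use S i iN in \<open>auto simp: cfull_def\<close>)
  also have "\<dots> \<le> 2"
    using inverse_deg_le[of "enc (Cap c (M + 1))"] inverse_deg_le[of "enc (Tr c i 1)"] by simp
  finally have l: "load S (enc (Cl c i)) \<le> 2" .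
  have "1 / 18 \<le> measure_pmf.prob (rand_rpull_step V E S) {S'. enc (Tr c i 1) \<in> S'}"
    by (rule pull_one[where y="Cl c i" and d=3 and l=2])
       (use S i iN l deg_Tr[OF node] node in \<open>auto simp: touched_def cfull_def\<close>)
  also have "\<dots> \<le> measure_pmf.prob (rand_rpull_step V E S) {S'. touched c i S'}"
    using node by (intro measure_pmf.finite_measure_mono) (auto simp: touched_def)
  finally show "1 / 18 \<le> measure_pmf.prob (rand_rpull_step V E S) {S'. touched c i S'}" .
qed (intro mono_intros)+

text \<open>Covers sources that are caps. The load may be of order \<open>sz i\<close>, but
  \<open>sz i\<close> leaves compete for the answer, so one of them wins with constant
  probability.\<close>

lemma Cap_touched:
  assumes i: "i \<le> M + 1"
  shows "reach \<tau> \<epsilon> (\<lambda>S. enc (Cap c i) \<in> S) (touched c i)"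
proof (rule reach_wait_\<tau>)
  fix S assume S: "S \<subseteq> V" "enc (Cap c i) \<in> S" "\<not> touched c i S"
  have l: "load S (enc (Cap c i)) \<le> 3 * real (sz i)"
    using load_le_deg[of S "enc (Cap c i)"] deg_Cap[OF i, of c] by linarith
  have "1 / 18 \<le> measure_pmf.prob (rand_rpull_step V E S) {S'. \<exists>x\<in>Tr c i ` {sz i..<2 * sz i}. enc x \<in> S'}"
  proof (rule push_many[where d=3])
    show "1 / 18 \<le> real (card (Tr c i ` {sz i..<2 * sz i})) / (real 3 * (1 + 3 * real (sz i)))"
      using sz_ge[of i] by (simp add: card_Tr_leaves divide_simps)
    show "deg (enc x) \<le> 3" if "x \<in> Tr c i ` {sz i..<2 * sz i}" for x
      using that i sz_ge[of i] by (auto intro!: deg_Tr)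
  qed (use S i l sz_ge[of i] in \<open>auto simp: touched_def\<close>)
  also have "\<dots> \<le> measure_pmf.prob (rand_rpull_step V E S) {S'. touched c i S'}"
    using sz_ge[of i] by (intro measure_pmf.finite_measure_mono) (force simp: touched_def)+
  finally show "1 / 18 \<le> measure_pmf.prob (rand_rpull_step V E S) {S'. touched c i S'}" .
qed (intro mono_intros)+

lemma Dec_touched:
  assumes i: "i < M"
  shows "reach \<tau> \<epsilon> (\<lambda>S. enc (Dec c i) \<in> S) (touched c i)"
proof (rule reach_wait_\<tau>)
  fix S assume S: "S \<subseteq> V" "enc (Dec c i) \<in> S" "\<not> touched c i S"
  have l: "load S (enc (Dec c i)) \<le> real (k + 1)"
    using load_le_deg[of S "enc (Dec c i)"] deg_Dec[OF i, of c] by simp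
  have "1 / 18 \<le> measure_pmf.prob (rand_rpull_step V E S) {S'. \<exists>x\<in>Tr c i ` {M..<M + k}. enc x \<in> S'}"
  proof (rule push_many[where d=3])
    show "1 / 18 \<le> real (card (Tr c i ` {M..<M + k})) / (real 3 * (1 + real (k + 1)))"
      using k_pos by (simp add: card_Tr_leaves divide_simps)
    show "deg (enc x) \<le> 3" if "x \<in> Tr c i ` {M..<M + k}" for x
      using that i M_ge k_le by (auto intro!: deg_Tr)
  qed (use S i l M_ge k_le in \<open>auto simp: touched_def\<close>)
  also have "\<dots> \<le> measure_pmf.prob (rand_rpull_step V E S) {S'. touched c i S'}"
    using i M_ge k_le by (intro measure_pmf.finite_measure_mono) (force simp: touched_def)+
  finally show "1 / 18 \<le> measure_pmf.prob (rand_rpull_step V E S) {S'. touched c i S'}" .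
qed (intro mono_intros)+

lemma full_touched_other:
  "reach \<tau> \<epsilon> (full c M) (touched (\<not> c) M)"
proof (rule reach_wait_\<tau>)
  fix S assume S: "S \<subseteq> V" "full c M S" "\<not> touched (\<not> c) M S"
  have "1 / 18 \<le> measure_pmf.prob (rand_rpull_step V E S) {S'. enc (Tr (\<not> c) M 1) \<in> S'}"
    by (rule pull_Tr_Tr[where c'=c and i'=M and j'=1])
       (use S M_ge in \<open>auto simp: touched_def full_def\<close>)
  also have "\<dots> \<le> measure_pmf.prob (rand_rpull_step V E S) {S'. touched (\<not> c) M S'}"
    using M_ge by (intro measure_pmf.finite_measure_mono) (auto simp: touched_def)
  finally show "1 / 18 \<le> measure_pmf.prob (rand_rpull_step V E S) {S'. touched (\<not> c) M S'}" .
qed (intro mono_intros)+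

section \<open>Growth inside the clique\<close>

definition informed_Cl :: "bool \<Rightarrow> nat set \<Rightarrow> nat set" where
  "informed_Cl c S = {j. j < N \<and> enc (Cl c j) \<in> S}"

lemma load_Cl: "j < N \<Longrightarrow> load S (enc (Cl c j)) \<le> 3"
proof -
  assume j: "j < N"
  have "load S (enc (Cl c j)) \<le> (\<Sum>z\<in>Cl c ` {..<N} \<union> {Cap c (M + 1), Tr c j 1}. 1 / real (deg (enc z)))"
    by (rule load_enc_le) (use j in \<open>auto split: if_splits\<close>)
  also have "\<dots> = (\<Sum>z\<in>Cl c ` {..<N}. 1 / real (deg (enc z))) + (\<Sum>z\<in>{Cap c (M + 1), Tr c j 1}. 1 / real (deg (enc z)))"
    by (rule sum.union_disjoint) auto
  also have "\<dots> \<le> 1 + 2"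
    using sum_Cl_le[of "{..<N}" c] inverse_deg_le[of "enc (Cap c (M + 1))"] inverse_deg_le[of "enc (Tr c j 1)"]
    by (intro add_mono) auto
  finally show ?thesis by simp
qed

lemma finite_informed_Cl: "finite (informed_Cl c S)"
  by (simp add: informed_Cl_def)

lemma mono_informed_Cl: "mono (\<lambda>S. r \<le> real (card (informed_Cl c S)))"
proof -
  have "card (informed_Cl c S) \<le> card (informed_Cl c S')" if "S \<subseteq> S'" for S S'
    by (rule card_mono[OF finite_informed_Cl]) (use that in \<open>auto simp: informed_Cl_def\<close>)
  then have "real (card (informed_Cl c S)) \<le> real (card (informed_Cl c S'))" if "S \<subseteq> S'" for S S'
    using that by simp
  then show ?thesis unfolding mono_def le_bool_def using order_trans by blast
qed

text \<open>While half of the clique is uninformed, each informed clique node answers a new one with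
  probability about \<open>1 / 8\<close>; \<open>growth_prob\<close> turns this mean into a growth
  factor.\<close>

lemma informed_Cl_growth:
  assumes S: "S \<subseteq> V" and c1: "1 \<le> real (card (informed_Cl c S))" and c2: "real (card (informed_Cl c S)) \<le> real N / 2"
  shows "1 / 18 \<le> measure_pmf.prob (rand_rpull_step V E S) {S'. 19 / 18 * real (card (informed_Cl c S)) \<le> real (card (informed_Cl c S'))}"
proof -
  define A where "A = {..<N} - informed_Cl c S"
  have cA: "card A = N - card (informed_Cl c S)" "card (informed_Cl c S) \<le> N"
    using card_mono[of "{..<N}" "informed_Cl c S"] card_Diff_subset[OF finite_informed_Cl, of c S "{..<N}"]
    by (auto simp: A_def informed_Cl_def)
  have cU: "card (enc ` Cl c ` A) = card A" and cX: "card (enc ` Cl c ` informed_Cl c S) = card (informed_Cl c S)"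
    by (subst card_image; simp add: card_Cl inj_on_def)+
  have "1 / 18 \<le> measure_pmf.prob (rand_rpull_step V E S)
      {S'. real (card (S' \<inter> enc ` Cl c ` A)) \<ge> 1 / 18 * real (card (enc ` Cl c ` informed_Cl c S))}"
  proof (rule growth_prob[where d="N + 1" and l=3])
    show "2 * (1 / 18) \<le> real (card (enc ` Cl c ` A)) / (real (N + 1) * (1 + 3))"
      unfolding cU using cA c2 N_ge by (simp add: divide_simps)
    show "enc ` Cl c ` informed_Cl c S \<noteq> {}" using c1 by auto
  qed (use S load_Cl deg_Cl in \<open>auto simp: A_def informed_Cl_def\<close>)
  also have "\<dots> \<le> measure_pmf.prob (rand_rpull_step V E S) {S'. 19 / 18 * real (card (informed_Cl c S)) \<le> real (card (informed_Cl c S'))}"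
  proof (rule measure_pmf.finite_measure_mono_AE)
    have "19 / 18 * real (card (informed_Cl c S)) \<le> real (card (informed_Cl c S'))"
      if S': "S' \<in> set_pmf (rand_rpull_step V E S)"
        and le: "1 / 18 * real (card (enc ` Cl c ` informed_Cl c S)) \<le> real (card (S' \<inter> enc ` Cl c ` A))" for S'
    proof -
      have sub: "S \<subseteq> S'" using set_rand_rpull_step(1)[OF S S'] .
      have "S' \<inter> enc ` Cl c ` A = enc ` Cl c ` (informed_Cl c S' - informed_Cl c S)"
        by (auto simp: A_def informed_Cl_def)
      then have "card (S' \<inter> enc ` Cl c ` A) = card (informed_Cl c S' - informed_Cl c S)"
        by (simp add: card_image inj_on_def)
      also have "\<dots> = card (informed_Cl c S') - card (informed_Cl c S)"
        by (rule card_Diff_subset[OF finite_informed_Cl]) (use sub in \<open>auto simp: informed_Cl_def\<close>)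
      finally have "card (S' \<inter> enc ` Cl c ` A) = card (informed_Cl c S') - card (informed_Cl c S)" .
      moreover have "card (informed_Cl c S) \<le> card (informed_Cl c S')"
        by (rule card_mono[OF finite_informed_Cl]) (use sub in \<open>auto simp: informed_Cl_def\<close>)
      ultimately show ?thesis using le cX by simp
    qed
    then show "AE x in measure_pmf (rand_rpull_step V E S).
       x \<in> {S'. 1 / 18 * real (card (enc ` Cl c ` informed_Cl c S)) \<le> real (card (S' \<inter> enc ` Cl c ` A))} \<longrightarrow>
       x \<in> {S'. 19 / 18 * real (card (informed_Cl c S)) \<le> real (card (informed_Cl c S'))}"
      by (simp add: AE_measure_pmf_iff)
  qed simp
  finally show ?thesis .
qed

lemma ctouched_cfull: "reach \<tau> \<epsilon> (ctouched c) (cfull c)"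
proof -
  \<comment> \<open>The target is cut off at \<open>N / 2\<close> because the growth estimate holds
    only up to there.\<close>
  define G where "G m S \<longleftrightarrow> min ((19 / 18) ^ m) (real N / 2) \<le> real (card (informed_Cl c S))" for m S
  have monoG: "mono (G m)" for m unfolding G_def[abs_def] by (rule mono_informed_Cl)
  have grow: "reach T \<delta> (G m) (G (Suc m))" for m
  proof (rule reach_wait_T[OF monoG monoG])
    fix S assume S: "S \<subseteq> V" "G m S" "\<not> G (Suc m) S"
    then have lt: "real (card (informed_Cl c S)) < real N / 2" "(19 / 18) ^ m \<le> real (card (informed_Cl c S))"
      by (auto simp: G_def min_def split: if_splits)
    moreover have "(1::real) \<le> (19 / 18) ^ m" by simp
    ultimately have "1 / 18 \<le> measure_pmf.prob (rand_rpull_step V E S) {S'. 19 / 18 * real (card (informed_Cl c S)) \<le> real (card (informed_Cl c S'))}"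
      by (intro informed_Cl_growth S) linarith+
    also have "\<dots> \<le> measure_pmf.prob (rand_rpull_step V E S) {S'. G (Suc m) S'}"
      using lt(2) by (intro measure_pmf.finite_measure_mono) (auto simp: G_def)
    finally show "1 / 18 \<le> measure_pmf.prob (rand_rpull_step V E S) {S'. G (Suc m) S'}" .
  qed
  have "reach (26 * a * T) (real (26 * a) * \<delta>) (G 0) (G (26 * a))"
    using grow \<delta>_pos monoG by (intro reach_chain) auto
  moreover have "reach T (real (card {..<N}) * \<delta>) (G (26 * a)) (cfull c)"
    unfolding cfull_def[abs_def]
  proof (intro reach_all reach_wait_T monoG mono_mem)
    fix j S assume j: "j \<in> {..<N}" and S: "S \<subseteq> V" "G (26 * a) S" "enc (Cl c j) \<notin> S"
    \<comment> \<open>Thirteen growth steps double the count, and \<open>N = 2 ^ (2 * a)\<close>;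
      hence the \<open>26 * a\<close> steps.\<close>
    have "(2::real) \<le> (19 / 18) ^ 13" by (simp add: power_divide)
    then have "(2::real) ^ (2 * a) \<le> ((19 / 18) ^ 13) ^ (2 * a)" by (intro power_mono) auto
    also have "\<dots> = (19 / 18) ^ (26 * a)" by (simp flip: power_mult)
    finally have "real N \<le> (19 / 18) ^ (26 * a)" by (simp add: N_def M_def power_mult mult.commute)
    then have half: "real N / 2 \<le> real (card (informed_Cl c S))" using S(2) by (auto simp: G_def min_def split: if_splits)
    show "1 / 18 \<le> measure_pmf.prob (rand_rpull_step V E S) {S'. enc (Cl c j) \<in> S'}"
    proof (rule pull_many[where Y="Cl c ` informed_Cl c S" and d="N + 1" and l=3])
      show "1 / 18 \<le> real (card (Cl c ` informed_Cl c S)) / (real (N + 1) * (1 + 3))"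
        unfolding card_Cl using half N_ge by (simp add: divide_simps)
    qed (use S j load_Cl deg_Cl in \<open>auto simp: informed_Cl_def\<close>)
  qed simp
  ultimately have "reach (26 * a * T + T) (real (26 * a) * \<delta> + real (card {..<N}) * \<delta>) (G 0) (cfull c)"
    using \<delta>_pos by (intro reach_trans[of _ _ _ "G (26 * a)"]) auto
  then have R: "reach \<tau> (real (26 * a) * \<delta> + real (card {..<N}) * \<delta>) (G 0) (cfull c)"
  proof (rule reach_mono_time[OF _ mono_cfull])
    have "216 * a \<le> 216 * (a * a)" by simp
    then show "26 * a * T + T \<le> \<tau>" by (simp add: T_def \<tau>_def power2_eq_square)
  qed
  show ?thesis
  proof (rule reach_weaken[OF R])
    fix S assume "ctouched c S"
    then have "informed_Cl c S \<noteq> {}" by (auto simp: ctouched_def informed_Cl_def)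
    then have "card (informed_Cl c S) \<ge> 1" using finite_informed_Cl by (simp add: Suc_leI card_gt_0_iff)
    then show "G 0 S" by (auto simp: G_def)
  next
    have "26 * a + N \<le> M * N"
    proof -
      have "26 * a \<le> N" using exp_ge M_le_N by simp
      moreover have "16 * N \<le> M * N" using M_ge by (rule mult_le_mono1)
      ultimately show ?thesis using N_ge by linarith
    qed
    also have "\<dots> \<le> N * N" using M_le_N by (intro mult_le_mono1) simp
    also have "\<dots> = M ^ 4" by (simp add: N_def power2_eq_square power4_eq_xxxx)
    finally have "real (26 * a + N) \<le> real M ^ 4" by (metis of_nat_le_iff of_nat_power)
    from \<delta>_le_\<epsilon>[OF this] show "real (26 * a) * \<delta> + real (card {..<N}) * \<delta> \<le> \<epsilon>"
      by (simp add: algebra_simps)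
  qed
qed

text \<open>One counter for both time and failure. The factor \<open>M ^ 2\<close> pays for treating
  up to \<open>M ^ 2\<close> components in parallel within a stage.\<close>

definition stages :: "nat \<Rightarrow> (nat set \<Rightarrow> bool) \<Rightarrow> (nat set \<Rightarrow> bool) \<Rightarrow> bool" where
  "stages n Q R \<longleftrightarrow> reach (n * \<tau>) (real n * (real M ^ 2 * \<epsilon>)) Q R"

lemma stages_trans: "stages m P Q \<Longrightarrow> stages n Q R \<Longrightarrow> stages (m + n) P R"
  unfolding stages_def using \<epsilon>_pos
    reach_trans[of "m * \<tau>" "real m * (real M ^ 2 * \<epsilon>)" P Q "n * \<tau>" "real n * (real M ^ 2 * \<epsilon>)" R]
  by (simp add: algebra_simps)

lemma stages_1:
  assumes "reach \<tau> \<epsilon> Q R"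
  shows "stages 1 Q R"
proof -
  have "1 * \<epsilon> \<le> real M ^ 2 * \<epsilon>" using M_ge \<epsilon>_pos by (intro mult_right_mono) auto
  then show ?thesis unfolding stages_def using reach_weaken[OF assms] by auto
qed

lemma stages_pad:
  assumes "stages m Q R" "mono R" "m \<le> n"
  shows "stages n Q R"
proof -
  have "m * \<tau> \<le> n * \<tau>" using assms(3) by (rule mult_le_mono1)
  then have "reach (n * \<tau>) (real m * (real M ^ 2 * \<epsilon>)) Q R"
    using assms unfolding stages_def by (blast intro: reach_mono_time)
  moreover have "real m * (real M ^ 2 * \<epsilon>) \<le> real n * (real M ^ 2 * \<epsilon>)"
    using assms(3) \<epsilon>_pos by (intro mult_right_mono) auto
  ultimately show ?thesis unfolding stages_def by (auto elim!: reach_weaken)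
qed

lemma stages_refl: "mono Q \<Longrightarrow> stages 0 Q Q"
  unfolding stages_def using reach_refl[of Q 0] by simp

lemma stages_keep:
  assumes "reach \<tau> \<epsilon> Q R" "mono Q"
  shows "stages 1 Q (\<lambda>S. Q S \<and> R S)"
  using assms by (intro stages_1 reach_keep)

lemma stages_all:
  assumes "mono Q" "finite X" "card X \<le> M ^ 2"
    and reach: "\<And>x. x \<in> X \<Longrightarrow> reach \<tau> \<epsilon> (P x) (R x)"
    and Q: "\<And>x S. x \<in> X \<Longrightarrow> Q S \<Longrightarrow> P x S"
  shows "stages 1 Q (\<lambda>S. Q S \<and> (\<forall>x\<in>X. R x S))"
proof -
  have "reach \<tau> \<epsilon> Q (R x)" if "x \<in> X" for x
    using reach_weaken[OF reach[OF that]] Q[OF that] by blast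
  then have "reach \<tau> (real (card X) * \<epsilon>) Q (\<lambda>S. \<forall>x\<in>X. R x S)"
    using assms(2) by (intro reach_all)
  then have "reach \<tau> (real (card X) * \<epsilon>) Q (\<lambda>S. Q S \<and> (\<forall>x\<in>X. R x S))"
    using assms(1) by (rule reach_keep)
  moreover have "real (card X) \<le> real M ^ 2" using assms(3) by (metis of_nat_le_iff of_nat_power)
  then have "real (card X) * \<epsilon> \<le> real M ^ 2 * \<epsilon>" using \<epsilon>_pos by (intro mult_right_mono) auto
  ultimately show ?thesis unfolding stages_def by (auto elim!: reach_weaken)
qed

lemma stages_K_hub:
  assumes i: "i < M"
  shows "stages 3 (full c i) (full c M)"
proof -
  have "stages (1 + (1 + 1)) (full c i) (full c M)"
    by (rule stages_trans[OF stages_keep[OF full_Cap mono_full]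
        stages_trans[OF stages_1[OF Cap_touched_hub] stages_1[OF touched_full]]]) (use i in auto)
  then show ?thesis by (simp add: numeral_3_eq_3)
qed

text \<open>The informed clique leads to the hub tree through any blob; blob 0 is chosen.\<close>

lemma stages_clique_hub: "stages 6 (ctouched c) (full c M)"
proof -
  have 0: "0 < M" using M_ge by simp
  have "stages (1 + (1 + (1 + 3))) (ctouched c) (full c M)"
    by (rule stages_trans[OF stages_1[OF ctouched_cfull] stages_trans[OF stages_1[OF cfull_touched[OF 0]]
        stages_trans[OF stages_1[OF touched_full] stages_K_hub[OF 0]]]]) auto
  then show ?thesis by simp
qed

lemma stages_tree_hub:
  assumes i: "i \<le> M + 1"
  shows "stages 8 (full c i) (full c M)"
proof (rule linorder_cases[of i M])
  assume "i < M"
  then show ?thesis by (rule stages_pad[OF stages_K_hub mono_full]) simp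
next
  assume "i = M"
  then show ?thesis using stages_pad[OF stages_refl[OF mono_full] mono_full, of 8 c M] by simp
next
  assume "M < i"
  then have "i = M + 1" using i by simp
  moreover have "stages (1 + (1 + 6)) (full c (M + 1)) (full c M)"
    by (rule stages_trans[OF stages_keep[OF full_Cap mono_full]
        stages_trans[OF stages_1[OF Cap_ctouched] stages_clique_hub]]) auto
  ultimately show ?thesis by simp
qed

lemma stages_touched_hub:
  assumes "i \<le> M + 1"
  shows "stages 9 (touched c i) (full c M)"
  using stages_trans[OF stages_1[OF touched_full[OF assms]] stages_tree_hub[OF assms]] by simp

lemma stages_node_hub:
  assumes "is_node x"
  shows "\<exists>c. stages 10 (\<lambda>S. enc x \<in> S) (full c M)"
proof (cases x)
  case (Tr c i j)
  have "stages 9 (\<lambda>S. enc x \<in> S) (full c M)"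
    using stages_touched_hub[of i c] assms Tr unfolding stages_def
    by (auto elim!: reach_weaken simp: touched_def intro!: bexI[of _ j])
  then have "stages 10 (\<lambda>S. enc x \<in> S) (full c M)" by (rule stages_pad) (auto intro: mono_full)
  then show ?thesis by blast
next
  case (Cap c i)
  then show ?thesis
    using stages_trans[OF stages_1[OF Cap_touched] stages_touched_hub, of i c] assms by auto
next
  case (Dec c i)
  then show ?thesis
    using stages_trans[OF stages_1[OF Dec_touched] stages_touched_hub, of i c] assms by auto
next
  case (Cl c j)
  then have "stages 6 (\<lambda>S. enc x \<in> S) (full c M)"
    using stages_clique_hub[of c] assms unfolding stages_def
    by (auto elim!: reach_weaken simp: ctouched_def)
  then have "stages 10 (\<lambda>S. enc x \<in> S) (full c M)" by (rule stages_pad) (auto intro: mono_full)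
  then show ?thesis by blast
qed

text \<open>The predicates from here to \<open>trees\<close> are nested, each containing the
  previous one, so that progress in both copies is accumulated along the stages.\<close>

definition hubs :: "nat set \<Rightarrow> bool" where
  "hubs S \<longleftrightarrow> (\<forall>c\<in>UNIV. full c M S)"

definition wtrees :: "nat set \<Rightarrow> bool" where
  "wtrees S \<longleftrightarrow> hubs S \<and> (\<forall>c\<in>UNIV. full c (M + 1) S)"

definition cliques :: "nat set \<Rightarrow> bool" where
  "cliques S \<longleftrightarrow> wtrees S \<and> (\<forall>c\<in>UNIV. cfull c S)"

definition trees :: "nat set \<Rightarrow> bool" where
  "trees S \<longleftrightarrow> cliques S \<and> (\<forall>(c, i)\<in>UNIV \<times> {..<M}. full c i S)"

lemma mono_hubs: "mono hubs"
  unfolding hubs_def[abs_def] by (intro mono_intros)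

lemma mono_wtrees: "mono wtrees"
  unfolding wtrees_def[abs_def] by (intro mono_intros mono_hubs)

lemma mono_cliques: "mono cliques"
  unfolding cliques_def[abs_def] by (intro mono_intros mono_wtrees)

lemma mono_trees: "mono trees"
  unfolding trees_def[abs_def] by (intro mono_intros mono_cliques) (auto intro: mono_intros)

lemma cards: "card (UNIV :: bool set) \<le> M ^ 2" "card ((UNIV :: bool set) \<times> {..<M}) \<le> M ^ 2"
  "card ((UNIV :: bool set) \<times> {..M + 1}) \<le> M ^ 2"
  using M_le_N M_ge unfolding N_def by (auto simp: card_cartesian_product)

lemma stages_hubs: "stages 2 (full c M) hubs"
proof -
  have "stages 1 (full c M) (\<lambda>S. full c M S \<and> touched (\<not> c) M S)"
    by (rule stages_keep[OF full_touched_other mono_full])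
  moreover have "stages 1 (\<lambda>S. full c M S \<and> touched (\<not> c) M S)
     (\<lambda>S. (full c M S \<and> touched (\<not> c) M S) \<and> (\<forall>c\<in>{\<not> c}. full c M S))"
    by (rule stages_all[where P="\<lambda>c. touched c M"]) (use M_ge in \<open>auto intro!: mono_intros touched_full\<close>)
  ultimately have "stages (1 + 1) (full c M) (\<lambda>S. (full c M S \<and> touched (\<not> c) M S) \<and> (\<forall>c\<in>{\<not> c}. full c M S))"
    by (rule stages_trans)
  moreover have "hubs S" if "(full c M S \<and> touched (\<not> c) M S) \<and> (\<forall>c\<in>{\<not> c}. full c M S)" for S
  proof -
    have "full b M S" for b using that by (cases "b = c") auto
    then show ?thesis by (simp add: hubs_def)
  qed
  ultimately show ?thesis unfolding stages_def by (auto elim!: reach_weaken simp: numeral_2_eq_2)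
qed

lemma stages_wtrees: "stages 3 hubs wtrees"
proof -
  let ?A = "\<lambda>S. hubs S \<and> (\<forall>c\<in>UNIV. enc (Cap c M) \<in> S)"
  let ?B = "\<lambda>S. ?A S \<and> (\<forall>c\<in>UNIV. touched c (M + 1) S)"
  let ?C = "\<lambda>S. ?B S \<and> (\<forall>c\<in>UNIV. full c (M + 1) S)"
  have "stages 1 hubs ?A"
    by (rule stages_all[OF mono_hubs _ cards(1) full_Cap]) (auto simp: hubs_def)
  moreover have "stages 1 ?A ?B"
    by (rule stages_all[OF _ _ cards(1) hub_touched]) (auto intro!: mono_intros mono_hubs simp: hubs_def)
  moreover have "stages 1 ?B ?C"
    by (rule stages_all[OF _ _ cards(1) touched_full]) (auto intro!: mono_intros mono_hubs)
  ultimately have "stages (1 + (1 + 1)) hubs ?C" by (intro stages_trans)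
  then show ?thesis unfolding stages_def
    by (auto elim!: reach_weaken simp: numeral_3_eq_3 wtrees_def)
qed

lemma stages_cliques: "stages 3 wtrees cliques"
proof -
  let ?A = "\<lambda>S. wtrees S \<and> (\<forall>c\<in>UNIV. enc (Cap c (M + 1)) \<in> S)"
  let ?B = "\<lambda>S. ?A S \<and> (\<forall>c\<in>UNIV. ctouched c S)"
  let ?C = "\<lambda>S. ?B S \<and> (\<forall>c\<in>UNIV. cfull c S)"
  have "stages 1 wtrees ?A"
    by (rule stages_all[OF mono_wtrees _ cards(1) full_Cap]) (auto simp: wtrees_def)
  moreover have "stages 1 ?A ?B"
    by (rule stages_all[OF _ _ cards(1) Cap_ctouched]) (auto intro!: mono_intros mono_hubs mono_wtrees simp: wtrees_def)
  moreover have "stages 1 ?B ?C"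
    by (rule stages_all[OF _ _ cards(1) ctouched_cfull]) (auto intro!: mono_intros mono_wtrees)
  ultimately have "stages (1 + (1 + 1)) wtrees ?C" by (intro stages_trans)
  then show ?thesis unfolding stages_def
    by (auto elim!: reach_weaken simp: numeral_3_eq_3 cliques_def)
qed

lemma stages_trees: "stages 2 cliques trees"
proof -
  let ?A = "\<lambda>S. cliques S \<and> (\<forall>p\<in>UNIV \<times> {..<M}. touched (fst p) (snd p) S)"
  let ?B = "\<lambda>S. ?A S \<and> (\<forall>p\<in>UNIV \<times> {..<M}. full (fst p) (snd p) S)"
  have "stages 1 cliques ?A"
    by (rule stages_all[OF mono_cliques _ cards(2) cfull_touched]) (auto simp: cliques_def)
  moreover have "stages 1 ?A ?B"
    by (rule stages_all[OF _ _ cards(2) touched_full]) (auto intro!: mono_intros mono_cliques)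
  ultimately have "stages (1 + 1) cliques ?B" by (intro stages_trans)
  then show ?thesis unfolding stages_def
    by (auto elim!: reach_weaken simp: numeral_2_eq_2 trees_def)
qed

lemma stages_all_nodes: "stages 2 trees (\<lambda>S. V \<subseteq> S)"
proof -
  let ?A = "\<lambda>S. trees S \<and> (\<forall>p\<in>UNIV \<times> {..M + 1}. enc (Cap (fst p) (snd p)) \<in> S)"
  let ?B = "\<lambda>S. ?A S \<and> (\<forall>p\<in>UNIV \<times> {..<M}. enc (Dec (fst p) (snd p)) \<in> S)"
  have full: "full c i S" if "trees S" "i \<le> M + 1" for c i S
  proof -
    have "i < M \<or> i = M \<or> i = M + 1" using that(2) by linarith
    then show ?thesis
      using that(1) by (auto simp: trees_def cliques_def wtrees_def hubs_def)
  qed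
  have "stages 1 trees ?A"
    by (rule stages_all[OF mono_trees _ cards(3) full_Cap]) (auto intro: full)
  moreover have "stages 1 ?A ?B"
    by (rule stages_all[OF _ _ cards(2) full_Dec]) (auto intro!: mono_intros mono_trees full)
  ultimately have "stages (1 + 1) trees ?B" by (intro stages_trans)
  moreover have "V \<subseteq> S" if "?B S" for S
  proof
    fix v assume "v \<in> V"
    then obtain x where x: "v = enc x" "is_node x" by (auto simp: V_def)
    show "v \<in> S"
    proof (cases x)
      case (Tr c i j)
      then show ?thesis using full[of S i c] that x by (auto simp: full_def)
    next
      case (Cl c j)
      then show ?thesis using that x by (auto simp: trees_def cliques_def cfull_def)
    qed (use that x in auto)
  qed
  ultimately show ?thesis unfolding stages_def
    by (auto elim!: reach_weaken simp: numeral_2_eq_2)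
qed

lemma \<delta>_le: "\<delta> \<le> 1 / real M ^ 12"
proof -
  have "2 \<le> exp (1::real)" using exp_ge_add_one_self[of "1::real"] by simp
  then have "2 ^ (12 * a) \<le> exp (1::real) ^ (12 * a)" by (intro power_mono) auto
  also have "\<dots> = exp (12 * real a)" by (simp flip: exp_of_nat_mult)
  finally have "real M ^ 12 \<le> exp (12 * real a)" by (simp add: M_def power_mult mult.commute)
  then have "1 / exp (12 * real a) \<le> 1 / real M ^ 12" using M_ge by (intro divide_left_mono) auto
  then show ?thesis by (simp add: \<delta>_def exp_minus inverse_eq_divide)
qed

text \<open>Ten stages to the hub tree of some copy and twelve more to all nodes take at most
  \<open>220000 * a^2\<close> rounds. The failure is at most \<open>22 * M^2 * M^4 / M^12\<close>,
  far below \<open>1 / (4 * N)\<close>.\<close>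

lemma random_upper_bound:
  assumes s: "s \<in> V" and t: "250000 * a\<^sup>2 \<le> t"
  shows "measure_pmf.prob (rand_rpull V E {s} t) {S. S \<noteq> V} \<le> 1 / (4 * real N)"
proof -
  obtain x where x: "s = enc x" "is_node x" using s by (auto simp: V_def)
  then obtain c where "stages 10 (\<lambda>S. s \<in> S) (full c M)" using stages_node_hub by blast
  then have "stages (10 + (2 + (3 + (3 + (2 + 2))))) (\<lambda>S. s \<in> S) (\<lambda>S. V \<subseteq> S)"
    by (intro stages_trans[OF _ stages_trans[OF stages_hubs stages_trans[OF stages_wtrees
        stages_trans[OF stages_cliques stages_trans[OF stages_trees stages_all_nodes]]]]])
  then have R: "reach (22 * \<tau>) (22 * (real M ^ 2 * \<epsilon>)) (\<lambda>S. s \<in> S) (\<lambda>S. V \<subseteq> S)"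
    by (simp add: stages_def)
  have "22 * \<tau> \<le> t" using t by (simp add: \<tau>_def)
  moreover have "mono (\<lambda>S. V \<subseteq> S)" by (auto simp: mono_def)
  ultimately have "reach t (22 * (real M ^ 2 * \<epsilon>)) (\<lambda>S. s \<in> S) (\<lambda>S. V \<subseteq> S)"
    using R by (blast intro: reach_mono_time)
  then have "measure_pmf.prob (rand_rpull V E {s} t) {S. \<not> V \<subseteq> S} \<le> 22 * (real M ^ 2 * \<epsilon>)"
    by (rule reachD) (use s in auto)
  also have "\<dots> \<le> 22 * (real M ^ 6 * (1 / real M ^ 12))"
  proof -
    have "real M ^ 6 * \<delta> \<le> real M ^ 6 * (1 / real M ^ 12)" using \<delta>_le by (intro mult_left_mono) auto
    then show ?thesis by (simp add: \<epsilon>_def flip: power_add mult.assoc)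
  qed
  also have "\<dots> = 22 / real M ^ 6"
    using M_ge by (simp add: field_simps flip: power_add)
  also have "\<dots> \<le> 1 / (4 * real M ^ 2)"
  proof -
    have "(16::real) ^ 4 \<le> real M ^ 4" using M_ge by (intro power_mono) auto
    then have "88 * real M ^ 2 \<le> real M ^ 4 * real M ^ 2" by (intro mult_right_mono) auto
    also have "\<dots> = real M ^ 6" by (simp flip: power_add)
    finally show ?thesis using M_ge by (simp add: divide_simps)
  qed
  finally have "measure_pmf.prob (rand_rpull V E {s} t) {S. \<not> V \<subseteq> S} \<le> 1 / (4 * real N)"
    by (simp add: N_def)
  moreover have "measure_pmf.prob (rand_rpull V E {s} t) {S. S \<noteq> V} \<le> measure_pmf.prob (rand_rpull V E {s} t) {S. \<not> V \<subseteq> S}"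
    by (rule measure_pmf.finite_measure_mono_AE)
       (use set_rand_rpull[of "{s}"] s in \<open>auto simp: AE_measure_pmf_iff\<close>)
  ultimately show ?thesis by linarith
qed

text \<open>From each source the random protocol informs everything with positive probability, which
  is possible only if every node is reachable.\<close>

lemma connected: "connected_graph V E"
proof -
  have "E\<^sup>*\<^sup>* s u" if s: "s \<in> V" and u: "u \<in> V" for s u
  proof -
    have "measure_pmf.prob (rand_rpull V E {s} (250000 * a\<^sup>2)) {S. S \<noteq> V} \<le> 1 / (4 * real N)"
      using s by (rule random_upper_bound) simp
    also have "\<dots> < 1" using N_ge by (simp add: divide_simps)
    finally have "measure_pmf.prob (rand_rpull V E {s} (250000 * a\<^sup>2)) {S. S \<noteq> V} \<noteq> 1" by simp
    then have "V \<in> set_pmf (rand_rpull V E {s} (250000 * a\<^sup>2))"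
      by (subst (asm) measure_pmf.prob_eq_1) (auto simp: AE_measure_pmf_iff)
    then show ?thesis using set_rand_rpull_connected[OF s] u by blast
  qed
  moreover have "V \<noteq> {}" using card_V_lower N_ge by auto
  ultimately show ?thesis using simple by (simp add: connected_graph_def)
qed

section \<open>The adversary\<close>

fun copy :: "node \<Rightarrow> bool" where
  "copy (Tr c i j) = c" | "copy (Cap c i) = c" | "copy (Dec c i) = c" | "copy (Cl c j) = c"

definition decoys :: "bool \<Rightarrow> nat set" where
  "decoys c = (\<lambda>i. enc (Dec c i)) ` {..<M}"

text \<open>The preference is applied at every node and uses only the last informed set; it matters
  only at the hub.\<close>

definition adv :: "bool \<Rightarrow> adversary" where
  "adv c h f v = (let R = req_set V (last h) f v in
     SOME u. u \<in> (if R \<inter> decoys c \<noteq> {} then R \<inter> decoys c else R))"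

lemma adv_in_req_set:
  assumes "v \<in> served V (last h) f"
  shows "adv c h f v \<in> req_set V (last h) f v"
    and "req_set V (last h) f v \<inter> decoys c \<noteq> {} \<Longrightarrow> adv c h f v \<in> decoys c"
proof -
  let ?R = "req_set V (last h) f v"
  have "?R \<noteq> {}" using assms by (simp add: served_def)
  then have "(if ?R \<inter> decoys c \<noteq> {} then ?R \<inter> decoys c else ?R) \<noteq> {}" by auto
  then have *: "adv c h f v \<in> (if ?R \<inter> decoys c \<noteq> {} then ?R \<inter> decoys c else ?R)"
    unfolding adv_def Let_def some_in_eq .
  then show "adv c h f v \<in> ?R" by (auto split: if_splits)
  show "?R \<inter> decoys c \<noteq> {} \<Longrightarrow> adv c h f v \<in> decoys c" using * by auto
qed

lemma valid_adv: "valid_adversary V (adv c)"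
  by (simp add: valid_adversary_def adv_in_req_set)

text \<open>The clique with its cap and its tree. The hub, the hub tree and the other copy belong
  neither to this region nor to a blob: the argument concedes them to the rumor for free.\<close>

fun in_W :: "bool \<Rightarrow> node \<Rightarrow> bool" where
  "in_W c (Tr c' i j) \<longleftrightarrow> c' = c \<and> i = M + 1"
| "in_W c (Cap c' i) \<longleftrightarrow> c' = c \<and> i = M + 1"
| "in_W c (Dec c' i) \<longleftrightarrow> False"
| "in_W c (Cl c' j) \<longleftrightarrow> c' = c"

fun in_blob :: "bool \<Rightarrow> nat \<Rightarrow> node \<Rightarrow> bool" where
  "in_blob c l (Tr c' i j) \<longleftrightarrow> c' = c \<and> i = l"
| "in_blob c l (Cap c' i) \<longleftrightarrow> c' = c \<and> i = l"
| "in_blob c l (Dec c' i) \<longleftrightarrow> c' = c \<and> i = l"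
| "in_blob c l (Cl c' j) \<longleftrightarrow> False"

definition W_hit :: "bool \<Rightarrow> nat set \<Rightarrow> bool" where
  "W_hit c S \<longleftrightarrow> (\<exists>x. in_W c x \<and> enc x \<in> S)"

definition blobs_hit :: "bool \<Rightarrow> nat set \<Rightarrow> nat set" where
  "blobs_hit c S = {i. i < M \<and> (\<exists>x. in_blob c i x \<and> enc x \<in> S)}"

text \<open>The factor 2 makes the potential saturate once half of the blobs are hit; before that,
  at least \<open>M / 2\<close> decoys are left to block the hub.\<close>

definition \<Phi> :: "bool \<Rightarrow> nat set \<Rightarrow> real" where
  "\<Phi> c S = (if W_hit c S then 1 else min 1 (2 * real (card (blobs_hit c S)) / real M))"

text \<open>Requiring \<open>x\<close> to be uninformed excludes the default value 0 of
  \<open>f\<close>, which might be the code of \<open>y\<close>.\<close>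

definition calls :: "node \<Rightarrow> node \<Rightarrow> nat set \<Rightarrow> (nat \<Rightarrow> nat) set" where
  "calls x y S = {f. enc x \<notin> S \<and> f (enc x) = enc y}"

text \<open>A decoy of an unhit blob is uninformed and hence really calls someone. The membership
  form matches \<open>requests_prob\<close>.\<close>

definition no_decoy_calls :: "bool \<Rightarrow> nat set \<Rightarrow> (nat \<Rightarrow> nat) set" where
  "no_decoy_calls c S = {f. \<forall>u\<in>(\<lambda>i. enc (Dec c i)) ` ({..<M} - blobs_hit c S). f u \<in> - {enc (Cap c M)}}"

lemma finite_blobs_hit [simp]: "finite (blobs_hit c S)"
  by (simp add: blobs_hit_def)

lemma \<Phi>_bounds: "0 \<le> \<Phi> c S" "\<Phi> c S \<le> 1"
  by (auto simp: \<Phi>_def)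

context
  fixes c :: bool and h :: "nat set list" and S :: "nat set" and f :: "nat \<Rightarrow> nat" and S' :: "nat set"
  assumes S: "S \<subseteq> V" "last h = S" and f: "f \<in> set_pmf (requests V E S)"
    and S'_def: "S' = S \<union> adv c h f ` served V S f"
begin

lemma newly_informed:
  assumes "enc x \<in> S'" "enc x \<notin> S"
  obtains y where "is_node x" "y \<in> nb x" "enc y \<in> S" "f (enc x) = enc y" "adv c h f (enc y) = enc x"
    "enc y \<in> served V S f"
proof -
  obtain v where v: "v \<in> served V S f" "enc x = adv c h f v" using assms by (auto simp: S'_def)
  then have r: "enc x \<in> req_set V S f v" using adv_in_req_set(1)[of v h f c] S by simp
  then have "is_node x" "f (enc x) = v" by (auto simp: req_set_def)
  moreover have "E (enc x) (f (enc x))"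
    by (rule set_requests[OF f]) (use r in \<open>auto simp: req_set_def\<close>)
  moreover have "v \<in> S" using v by (auto simp: served_def)
  ultimately show ?thesis using that v by (auto simp: E_def)
qed

text \<open>Only two kinds of edges enter this region: from the hub to the root of the clique tree,
  which the adversary uses only if no decoy calls, and from a blob root to its clique node.\<close>

lemma W_hit_step:
  assumes "\<not> W_hit c S" "W_hit c S'"
  shows "f \<in> no_decoy_calls c S \<or> (\<exists>i<M. f \<in> calls (Cl c i) (Tr c i 1) S)"
proof -
  obtain x where x: "in_W c x" "enc x \<in> S'" using assms(2) by (auto simp: W_hit_def)
  have xS: "enc x \<notin> S" using assms(1) x by (auto simp: W_hit_def)
  obtain y where y: "is_node x" "y \<in> nb x" "enc y \<in> S" "f (enc x) = enc y" "adv c h f (enc y) = enc x"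
    "enc y \<in> served V S f"
    using newly_informed[OF x(2) xS] by blast
  have yW: "\<not> in_W c y" using assms(1) y by (auto simp: W_hit_def)
  show ?thesis
  proof (cases x)
    case (Tr c' i j)
    then have yh: "y = Cap c M" using x y yW by (auto split: if_splits)
    have "f (enc (Dec c i)) \<noteq> enc (Cap c M)" if i: "i < M" "i \<notin> blobs_hit c S" for i
    proof
      assume *: "f (enc (Dec c i)) = enc (Cap c M)"
      have "enc (Dec c i) \<notin> S" using i by (auto simp: blobs_hit_def)
      then have "enc (Dec c i) \<in> req_set V (last h) f (enc y) \<inter> decoys c"
        using i * yh S by (auto simp: req_set_def decoys_def)
      then have "adv c h f (enc y) \<in> decoys c"
        using adv_in_req_set(2)[of "enc y" h f c] y S by auto
      then show False using y Tr by (auto simp: decoys_def)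
    qed
    then show ?thesis by (auto simp: no_decoy_calls_def)
  next
    case (Cap c' i)
    then show ?thesis using x y yW by (auto split: if_splits)
  next
    case (Dec c' i)
    then show ?thesis using x by simp
  next
    case (Cl c' j)
    then have "j < M" "y = Tr c j 1" using x y yW by (auto split: if_splits)
    then show ?thesis using Cl x y xS by (auto simp: calls_def)
  qed
qed

text \<open>A blob is entered from the hub through its decoy, from the hub tree through its cap, or
  from the clique through its root; the last way is closed while the clique part is unhit.\<close>

lemma blobs_hit_step:
  assumes "\<not> W_hit c S"
  shows "blobs_hit c S' \<subseteq> blobs_hit c S \<union> {i. enc (Dec c i) = adv c h f (enc (Cap c M))}
    \<union> {i. i < M \<and> f \<in> calls (Cap c i) (Tr c M (M + i)) S}"
proof
  fix i assume i: "i \<in> blobs_hit c S'"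
  show "i \<in> blobs_hit c S \<union> {i. enc (Dec c i) = adv c h f (enc (Cap c M))}
    \<union> {i. i < M \<and> f \<in> calls (Cap c i) (Tr c M (M + i)) S}"
  proof (cases "i \<in> blobs_hit c S")
    case False
    obtain x where x: "i < M" "in_blob c i x" "enc x \<in> S'" using i by (auto simp: blobs_hit_def)
    have xS: "enc x \<notin> S" using False x by (auto simp: blobs_hit_def)
    obtain y where y: "is_node x" "y \<in> nb x" "enc y \<in> S" "f (enc x) = enc y" "adv c h f (enc y) = enc x"
      using newly_informed[OF x(3) xS] by blast
    have yW: "\<not> in_W c y" using assms y by (auto simp: W_hit_def)
    have yB: "\<not> in_blob c i y" using False x y by (auto simp: blobs_hit_def)
    show ?thesis
    proof (cases x)
      case (Tr c' l j)
      then show ?thesis using x y yW yB by (auto split: if_splits)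
    next
      case (Cap c' l)
      then have "y = Tr c M (M + i)" using x y yW yB by (auto split: if_splits)
      then show ?thesis using Cap x y xS by (auto simp: calls_def)
    next
      case (Dec c' l)
      then have "y = Cap c M" using x y yW yB by (auto split: if_splits)
      then show ?thesis using Dec x y by auto
    next
      case (Cl c' j)
      then show ?thesis using x by simp
    qed
  qed simp
qed

text \<open>A pointwise bound by indicators of calls, so that the drift follows by linearity of
  expectation alone.\<close>

lemma \<Phi>_step:
  assumes "\<not> W_hit c S"
  shows "\<Phi> c S' \<le> 2 * real (card (blobs_hit c S)) / real M + indicator (no_decoy_calls c S) f
    + (\<Sum>i<M. indicator (calls (Cl c i) (Tr c i 1) S) f)
    + 2 / real M * (1 + (\<Sum>i<M. indicator (calls (Cap c i) (Tr c M (M + i)) S) f))"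
    (is "_ \<le> ?b + ?x + ?y + ?z")
proof -
  have nonneg: "0 \<le> ?b" "0 \<le> ?x" "0 \<le> ?y" "0 \<le> ?z"
    by (simp, simp, simp add: sum_nonneg)
       (intro sum_nonneg mult_nonneg_nonneg add_nonneg_nonneg; simp)
  show ?thesis
  proof (cases "W_hit c S'")
    case True
    have "1 \<le> ?x + ?y"
      using W_hit_step[OF assms True]
    proof
      assume "\<exists>i<M. f \<in> calls (Cl c i) (Tr c i 1) S"
      then obtain i where "i < M" "f \<in> calls (Cl c i) (Tr c i 1) S" by blast
      then have "1 \<le> ?y"
        using member_le_sum[of i "{..<M}" "\<lambda>i. indicator (calls (Cl c i) (Tr c i 1) S) f :: real"] by simp
      then show ?thesis using nonneg by linarith
    qed (use nonneg in auto)
    then show ?thesis using \<Phi>_bounds(2)[of c S'] nonneg by linarith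
  next
    case False
    let ?D = "{i. enc (Dec c i) = adv c h f (enc (Cap c M))}"
    let ?C = "{i. i < M \<and> f \<in> calls (Cap c i) (Tr c M (M + i)) S}"
    \<comment> \<open>The hub answers only one call per round, so it opens at most one blob.\<close>
    have D: "finite ?D \<and> card ?D \<le> 1"
    proof (cases "?D = {}")
      case False
      then obtain i where i: "enc (Dec c i) = adv c h f (enc (Cap c M))" by blast
      have "?D \<subseteq> {i}" unfolding i[symmetric] by auto
      then show ?thesis using card_mono[of "{i}" ?D] finite_subset by auto
    qed simp
    have "card (blobs_hit c S') \<le> card (blobs_hit c S \<union> ?D \<union> ?C)"
      using D by (intro card_mono[OF _ blobs_hit_step[OF assms]]) auto
    also have "\<dots> \<le> card (blobs_hit c S) + card ?D + card ?C"
      using card_Un_le[of "blobs_hit c S \<union> ?D" ?C] card_Un_le[of "blobs_hit c S" ?D] by linarith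
    finally have "real (card (blobs_hit c S')) \<le> real (card (blobs_hit c S)) + (1 + real (card ?C))"
      using D by simp
    moreover have "real (card ?C) = (\<Sum>i<M. indicator (calls (Cap c i) (Tr c M (M + i)) S) f)"
      by (simp add: indicator_def sum.If_cases Int_def)
    ultimately have "2 / real M * real (card (blobs_hit c S')) \<le> 2 / real M * (real (card (blobs_hit c S)) +
        (1 + (\<Sum>i<M. indicator (calls (Cap c i) (Tr c M (M + i)) S) f)))"
      by (intro mult_left_mono) auto
    then have "2 / real M * real (card (blobs_hit c S')) \<le> ?b + ?z"
      by (simp add: distrib_left)
    moreover have "\<Phi> c S' \<le> 2 / real M * real (card (blobs_hit c S'))"
      using False by (simp add: \<Phi>_def)
    ultimately show ?thesis using nonneg by linarith
  qed
qed

end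

lemma calls_prob:
  assumes "is_node x" "S \<subseteq> V" "m \<le> deg (enc x)" "0 < m" "y \<in> nb x"
  shows "measure_pmf.prob (requests V E S) (calls x y S) \<le> 1 / real m"
proof (cases "enc x \<in> S")
  case True
  then show ?thesis by (simp add: calls_def)
next
  case False
  then have "measure_pmf.prob (requests V E S) (calls x y S) = 1 / real (deg (enc x))"
    using assms by (simp add: calls_def requests_prob1)
  also have "\<dots> \<le> 1 / real m" using assms by (intro divide_left_mono) auto
  finally show ?thesis .
qed

text \<open>At least \<open>M / 2\<close> decoys miss the hub independently, each with probability
  \<open>k / (k + 1)\<close>; by \<open>k_upper\<close> the product is at most
  \<open>exp (- a)\<close>, and \<open>e\<close> is at least 2.\<close>

lemma no_decoy_calls_prob:
  assumes "2 * card (blobs_hit c S) \<le> M"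
  shows "measure_pmf.prob (requests V E S) (no_decoy_calls c S) \<le> 1 / real M"
proof -
  let ?I = "{..<M} - blobs_hit c S"
  have inj: "inj_on (\<lambda>i. enc (Dec c i)) ?I" by (auto simp: inj_on_def)
  have "measure_pmf.prob (requests V E S) (no_decoy_calls c S)
      = (\<Prod>u\<in>(\<lambda>i. enc (Dec c i)) ` ?I. real (card (nbrs E u \<inter> - {enc (Cap c M)})) / real (deg u))"
    unfolding no_decoy_calls_def
  proof (rule requests_prob)
    show "(\<lambda>i. enc (Dec c i)) ` ?I \<subseteq> V - S"
      by (auto simp: blobs_hit_def) (metis in_blob.simps(3))
  qed
  also have "\<dots> = (\<Prod>i\<in>?I. real k / real (k + 1))"
  proof (subst prod.reindex[OF inj], rule prod.cong[OF refl])
    fix i assume i: "i \<in> ?I"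
    have "nbrs E (enc (Dec c i)) \<inter> - {enc (Cap c M)} = enc ` Tr c i ` {M..<M + k}"
      using i by (subst nbrs_enc) auto
    moreover have "card (enc ` Tr c i ` {M..<M + k}) = k"
      by (subst card_image) (auto simp: card_Tr_leaves inj_on_def)
    ultimately show "((\<lambda>u. real (card (nbrs E u \<inter> - {enc (Cap c M)})) / real (deg u)) \<circ> (\<lambda>i. enc (Dec c i))) i
        = real k / real (k + 1)"
      using i by (simp add: deg_Dec)
  qed
  also have "\<dots> = (real k / real (k + 1)) ^ card ?I" by simp
  also have "\<dots> \<le> exp (- (1 / real (k + 1))) ^ card ?I"
  proof (rule power_mono)
    have "real k / real (k + 1) = 1 + - (1 / real (k + 1))" by (simp add: field_simps)
    then show "real k / real (k + 1) \<le> exp (- (1 / real (k + 1)))"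
      using exp_ge_add_one_self[of "- (1 / real (k + 1))"] by linarith
  qed simp
  also have "\<dots> = exp (- (real (card ?I) / real (k + 1)))"
    by (simp flip: exp_of_nat_mult)
  also have "\<dots> \<le> exp (- real a)"
  proof -
    have "card ?I = M - card (blobs_hit c S)"
      by (subst card_Diff_subset) (auto simp: blobs_hit_def)
    then have "real M / 2 \<le> real (card ?I)" using assms by simp
    moreover have "real a * real (k + 1) \<le> real M / 2"
    proof -
      have "real a * real (k + 1) \<le> real a * (real M / (2 * real a))" using k_upper by (intro mult_left_mono) auto
      then show ?thesis using a_ge by simp
    qed
    ultimately have "real a * real (k + 1) \<le> real (card ?I)" by linarith
    then have "real a \<le> real (card ?I) / real (k + 1)" by (simp add: pos_le_divide_eq)
    then show ?thesis by simp
  qed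
  also have "\<dots> \<le> 1 / real M"
  proof -
    have "2 \<le> exp (1::real)" using exp_ge_add_one_self[of "1::real"] by simp
    then have "2 ^ a \<le> exp (1::real) ^ a" by (intro power_mono) auto
    then have "real M \<le> exp (real a)" by (simp add: M_def flip: exp_of_nat_mult)
    then have "1 / exp (real a) \<le> 1 / real M" using M_ge by (intro divide_left_mono) auto
    then show ?thesis by (simp add: exp_minus inverse_eq_divide)
  qed
  finally show ?thesis .
qed

lemma \<Phi>_drift:
  assumes "S \<subseteq> V" "last h = S"
  shows "(\<integral>f. \<Phi> c (S \<union> adv c h f ` served V S f) \<partial>measure_pmf (requests V E S)) \<le> \<Phi> c S + 6 / real M"
proof -
  have int: "integrable (measure_pmf (requests V E S)) g" for g :: "_ \<Rightarrow> real"
    by (rule integrable_measure_pmf_finite[OF finite_set_requests])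
  show ?thesis
  proof (cases "\<not> W_hit c S \<and> 2 * card (blobs_hit c S) \<le> M")
    \<comment> \<open>The potential is already saturated here, so the drift cannot be
      positive.\<close>
    case False
    then have "\<Phi> c S = 1" using M_ge by (auto simp: \<Phi>_def min_def divide_simps)
    moreover have "(\<integral>f. \<Phi> c (S \<union> adv c h f ` served V S f) \<partial>measure_pmf (requests V E S))
        \<le> (\<integral>f. 1 \<partial>measure_pmf (requests V E S))"
      by (intro integral_mono int) (rule \<Phi>_bounds)
    then have "(\<integral>f. \<Phi> c (S \<union> adv c h f ` served V S f) \<partial>measure_pmf (requests V E S)) \<le> 1" by simp
    moreover have "0 \<le> 6 / real M" by simp
    ultimately show ?thesis by linarith
  next
    case True
    let ?P = "measure_pmf.prob (requests V E S)"
    let ?b = "2 * real (card (blobs_hit c S)) / real M"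
    have "(\<integral>f. \<Phi> c (S \<union> adv c h f ` served V S f) \<partial>measure_pmf (requests V E S))
       \<le> (\<integral>f. ?b + indicator (no_decoy_calls c S) f
         + (\<Sum>i<M. indicator (calls (Cl c i) (Tr c i 1) S) f)
         + 2 / real M * (1 + (\<Sum>i<M. indicator (calls (Cap c i) (Tr c M (M + i)) S) f)) \<partial>measure_pmf (requests V E S))"
      by (rule integral_mono_AE[OF int int])
         (use \<Phi>_step[OF assms] True in \<open>simp add: AE_measure_pmf_iff\<close>)
    also have "\<dots> = ?b + ?P (no_decoy_calls c S) + (\<Sum>i<M. ?P (calls (Cl c i) (Tr c i 1) S))
         + 2 / real M * (1 + (\<Sum>i<M. ?P (calls (Cap c i) (Tr c M (M + i)) S)))"
      by (simp add: int Bochner_Integration.integral_add Bochner_Integration.integral_sum del: times_divide_eq_left)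
    also have "\<dots> \<le> ?b + 1 / real M + (\<Sum>i<M. 1 / real N) + 2 / real M * (1 + (\<Sum>i<M. 1 / real M))"
    proof (intro add_mono mult_left_mono sum_mono)
      show "?P (no_decoy_calls c S) \<le> 1 / real M" using True by (intro no_decoy_calls_prob) simp
      fix i assume i: "i \<in> {..<M}"
      then have "i < N" using M_le_N by simp
      then show "?P (calls (Cl c i) (Tr c i 1) S) \<le> 1 / real N"
        using i deg_Cl[of i c] N_ge assms by (intro calls_prob) auto
      show "?P (calls (Cap c i) (Tr c M (M + i)) S) \<le> 1 / real M"
        using i deg_Cap_lower[of i c] M_ge assms by (intro calls_prob) auto
    qed auto
    \<comment> \<open>The 6 is made up of 1 for the hub, 1 for the \<open>M\<close> clique nodes
      calling at rate \<open>1 / N\<close>, and 4 for two newly hit blobs on average, one from the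
      hub and one from the caps.\<close>
    also have "\<dots> = ?b + 6 / real M"
      using M_ge by (simp add: N_def power2_eq_square field_simps)
    also have "?b = \<Phi> c S"
      using True M_ge by (auto simp: \<Phi>_def min_def divide_simps)
    finally show ?thesis .
  qed
qed

lemma last_adv_rpull:
  assumes "s \<in> V" "h \<in> set_pmf (adv_rpull V E (adv c) {s} t)"
  shows "last h \<subseteq> V"
  using assms(2)
proof (induction t arbitrary: h)
  case (Suc t)
  then obtain h' f where h': "h' \<in> set_pmf (adv_rpull V E (adv c) {s} t)"
    "h = h' @ [last h' \<union> adv c h' f ` served V (last h') f]"
    by (auto simp: adv_rpull_step_def)
  then show ?case using Suc.IH[OF h'(1)] adv_in_req_set(1)[of _ h' f c]
    by (auto simp: req_set_def)
qed (use assms(1) in auto)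

lemma expected_\<Phi>:
  assumes s: "s \<in> V" and 0: "\<Phi> c {s} = 0"
  shows "(\<integral>\<^sup>+h. ennreal (\<Phi> c (last h)) \<partial>measure_pmf (adv_rpull V E (adv c) {s} t)) \<le> ennreal (6 * real t / real M)"
proof (induction t)
  case 0
  then show ?case using assms by simp
next
  case (Suc t)
  let ?p = "adv_rpull V E (adv c) {s} t"
  have step: "(\<integral>\<^sup>+f. ennreal (\<Phi> c (last h \<union> adv c h f ` served V (last h) f)) \<partial>measure_pmf (requests V E (last h)))
      \<le> ennreal (\<Phi> c (last h)) + ennreal (6 / real M)" if "h \<in> set_pmf ?p" for h
  proof -
    have "(\<integral>\<^sup>+f. ennreal (\<Phi> c (last h \<union> adv c h f ` served V (last h) f)) \<partial>measure_pmf (requests V E (last h)))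
       = ennreal (\<integral>f. \<Phi> c (last h \<union> adv c h f ` served V (last h) f) \<partial>measure_pmf (requests V E (last h)))"
      by (intro nn_integral_eq_integral integrable_measure_pmf_finite finite_set_requests) (simp add: \<Phi>_bounds)
    also have "\<dots> \<le> ennreal (\<Phi> c (last h) + 6 / real M)"
      using last_adv_rpull[OF s that] by (intro ennreal_leI \<Phi>_drift) auto
    finally show ?thesis by (simp add: ennreal_plus \<Phi>_bounds)
  qed
  have "(\<integral>\<^sup>+h. ennreal (\<Phi> c (last h)) \<partial>measure_pmf (adv_rpull V E (adv c) {s} (Suc t)))
     = (\<integral>\<^sup>+h. (\<integral>\<^sup>+f. ennreal (\<Phi> c (last h \<union> adv c h f ` served V (last h) f)) \<partial>measure_pmf (requests V E (last h))) \<partial>measure_pmf ?p)"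
    by (simp add: adv_rpull_step_def)
  also have "\<dots> \<le> (\<integral>\<^sup>+h. ennreal (\<Phi> c (last h)) + ennreal (6 / real M) \<partial>measure_pmf ?p)"
    by (rule nn_integral_mono_AE) (use step in \<open>simp add: AE_measure_pmf_iff\<close>)
  also have "\<dots> = (\<integral>\<^sup>+h. ennreal (\<Phi> c (last h)) \<partial>measure_pmf ?p) + ennreal (6 / real M)"
    by (subst nn_integral_add) auto
  also have "\<dots> \<le> ennreal (6 * real t / real M) + ennreal (6 / real M)"
    using Suc by (intro add_mono) auto
  also have "\<dots> = ennreal (6 * real (Suc t) / real M)"
    by (simp add: add_divide_distrib distrib_left flip: ennreal_plus)
  finally show ?case .
qed

text \<open>In the copy without the source the potential starts at 0, and it is 1 when all nodes are
  informed. Markov's inequality thus makes completion within \<open>M / 12\<close> rounds at most as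
  likely as not.\<close>

lemma adversary_lower_bound:
  assumes s: "s \<in> V"
  shows "\<exists>c. adv_expected_time V E (adv c) {s} \<ge> ennreal (real M / 24)"
proof -
  obtain x where x: "s = enc x" by (metis V_def assms imageE)
  define c where "c = (\<not> copy x)"
  have "\<not> in_W c x" "\<not> in_blob c i x" for i by (cases x; auto simp: c_def)+
  then have 0: "\<Phi> c {s} = 0" by (auto simp: \<Phi>_def W_hit_def blobs_hit_def x)
  have "W_hit c V"
    unfolding W_hit_def using N_ge by (intro exI[of _ "Cl c 0"]) auto
  then have 1: "\<Phi> c V = 1" by (simp add: \<Phi>_def)
  let ?P = "\<lambda>t. measure_pmf.prob (adv_rpull V E (adv c) {s} t) {h. last h \<noteq> V}"
  have half: "1 / 2 \<le> ?P t" if t: "t \<le> M div 12" for t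
  proof -
    let ?p = "adv_rpull V E (adv c) {s} t"
    have "ennreal (measure_pmf.prob ?p {h. last h = V}) = (\<integral>\<^sup>+h. indicator {h. last h = V} h \<partial>measure_pmf ?p)"
      by (simp add: measure_pmf.emeasure_eq_measure)
    also have "\<dots> \<le> (\<integral>\<^sup>+h. ennreal (\<Phi> c (last h)) \<partial>measure_pmf ?p)"
      by (rule nn_integral_mono) (auto simp: indicator_def 1)
    also have "\<dots> \<le> ennreal (6 * real t / real M)" by (rule expected_\<Phi>[OF s 0])
    finally have "measure_pmf.prob ?p {h. last h = V} \<le> 6 * real t / real M" by simp
    also have "\<dots> \<le> 1 / 2"
    proof -
      have "12 * t \<le> M" using t by linarith
      then have "12 * real t \<le> real M" by (metis of_nat_le_iff of_nat_mult of_nat_numeral)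
      then show ?thesis using M_ge by (simp add: divide_simps)
    qed
    finally have "measure_pmf.prob ?p {h. last h = V} \<le> 1 / 2" .
    moreover have "?P t = 1 - measure_pmf.prob ?p {h. last h = V}"
      by (subst measure_pmf.prob_compl[symmetric]) (auto intro: arg_cong[where f="measure_pmf.prob _"])
    ultimately show ?thesis by simp
  qed
  \<comment> \<open>Counting round 0 contributes the \<open>+ 1\<close> that makes up for rounding
    in \<open>M div 12\<close>.\<close>
  have "real M / 24 \<le> real (M div 12 + 1) * (1 / 2)"
  proof -
    have "M \<le> 12 * (M div 12 + 1)" by presburger
    then have "real M \<le> 12 * real (M div 12 + 1)" by (metis of_nat_le_iff of_nat_mult of_nat_numeral)
    then show ?thesis by simp
  qed
  also have "\<dots> = (\<Sum>t<M div 12 + 1. 1 / 2)" by simp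
  also have "\<dots> \<le> (\<Sum>t<M div 12 + 1. ?P t)" using half by (intro sum_mono) auto
  finally have "ennreal (real M / 24) \<le> ennreal (\<Sum>t<M div 12 + 1. ?P t)" by (rule ennreal_leI)
  also have "\<dots> = (\<Sum>t<M div 12 + 1. ennreal (?P t))" by (rule sum_ennreal[symmetric]) simp
  also have "\<dots> \<le> (\<Sum>t. ennreal (?P t))" by (rule sum_le_suminf) auto
  finally show ?thesis unfolding adv_expected_time_def by blast
qed

end

theorem theorem1:
  "\<exists>c1 c2 c3 c4 :: real. \<exists>c :: real. \<exists>N0 :: nat.
     0 < c1 \<and> 0 < c2 \<and> 0 < c3 \<and> 0 < c4 \<and> 1 \<le> c \<and>
     (\<forall>n \<ge> N0. \<exists>V E.
        connected_graph V E \<and>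
        c1 * real n \<le> real (card V) \<and> real (card V) \<le> c2 * real n \<and>
        (\<forall>s \<in> V.
           (\<exists>adv. valid_adversary V adv \<and>
                  adv_expected_time V E adv {s} \<ge> ennreal (c3 * sqrt (real n))) \<and>
           measure_pmf.prob (rand_rpull V E {s} (nat \<lceil>c4 * (ln (real n))\<^sup>2\<rceil>)) {S. S \<noteq> V}
             \<le> real n powr (- c)))"
proof -
  have main: "\<exists>V E. connected_graph V E \<and>
        1 / 4 * real n \<le> real (card V) \<and> real (card V) \<le> 20 * real n \<and>
        (\<forall>s \<in> V.
           (\<exists>adv. valid_adversary V adv \<and>
                  adv_expected_time V E adv {s} \<ge> ennreal (1 / 48 * sqrt (real n))) \<and>
           measure_pmf.prob (rand_rpull V E {s} (nat \<lceil>250000 * (ln (real n))\<^sup>2\<rceil>)) {S. S \<noteq> V}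
             \<le> real n powr (- 1))" if n: "n \<ge> 256" for n :: nat
  proof -
    \<comment> \<open>Taking for \<open>N\<close> the largest power of 4 up to \<open>n\<close>
      costs at most a factor 4 in the size; the threshold \<open>256 = 4 ^ 4\<close> ensures
      \<open>4 \<le> a\<close>.\<close>
    obtain a where a: "4 ^ a \<le> n" "n < 4 ^ (a + 1)"
      using ex_power_ivl1[of 4 n] n by auto
    have "a \<ge> 4"
    proof (rule ccontr)
      assume "\<not> a \<ge> 4"
      then have "(4::nat) ^ (a + 1) \<le> 4 ^ 4" by (intro power_increasing) auto
      then show False using a n by simp
    qed
    then interpret gadget a by unfold_locales
    have "(2 ^ a)\<^sup>2 = ((2::nat)\<^sup>2) ^ a" by (simp only: power_mult[symmetric] mult.commute)
    then have N4: "N = 4 ^ a" by (simp add: N_def M_def)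
    have nN: "N \<le> n" "n < 4 * N" using a N4 by simp_all
    have "connected_graph V E" by (rule connected)
    moreover have "1 / 4 * real n \<le> real (card V)" using nN card_V_lower by simp
    moreover have "real (card V) \<le> 20 * real n" using nN card_V_upper by simp
    moreover have "\<exists>adv. valid_adversary V adv \<and>
        adv_expected_time V E adv {s} \<ge> ennreal (1 / 48 * sqrt (real n))" if s: "s \<in> V" for s
    proof -
      have "real n \<le> real (4 * N)" using nN(2) by (simp only: of_nat_le_iff less_imp_le)
      then have "sqrt (real n) \<le> sqrt (real (4 * N))" by (rule real_sqrt_le_mono)
      also have "\<dots> = sqrt ((2 * real M)\<^sup>2)" by (simp only: N_def) (simp add: power_mult_distrib)
      also have "\<dots> = 2 * real M" by (rule real_sqrt_unique) auto
      \<comment> \<open>As \<open>sqrt n\<close> is at most \<open>2 * M\<close>, the bound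
        \<open>M / 24\<close> becomes \<open>sqrt n / 48\<close>.\<close>
      finally have "ennreal (1 / 48 * sqrt (real n)) \<le> ennreal (real M / 24)" by (intro ennreal_leI) simp
      then show ?thesis using adversary_lower_bound[OF s] valid_adv order_trans by blast
    qed
    moreover have "measure_pmf.prob (rand_rpull V E {s} (nat \<lceil>250000 * (ln (real n))\<^sup>2\<rceil>)) {S. S \<noteq> V}
        \<le> real n powr (- 1)" if s: "s \<in> V" for s
    proof -
      \<comment> \<open>Because \<open>ln 4\<close> is at least 1, \<open>a\<close> is at most
        \<open>ln n\<close>, so the constant 250000 carries over unchanged.\<close>
      have "exp 1 \<le> (4::real)" using exp_le by simp
      then have "ln (exp 1) \<le> ln (4::real)" by (subst ln_le_cancel_iff) auto
      then have "real a * 1 \<le> real a * ln 4" by (intro mult_left_mono) auto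
      also have "\<dots> = ln (4 ^ a)" by (simp add: ln_realpow)
      also have "\<dots> \<le> ln (real n)"
      proof -
        have "(4::real) ^ a = real N" by (simp add: N4)
        then show ?thesis using nN N_ge by (subst ln_le_cancel_iff) auto
      qed
      finally have "(real a)\<^sup>2 \<le> (ln (real n))\<^sup>2" by (intro power_mono) auto
      then have "real (250000 * a\<^sup>2) \<le> 250000 * (ln (real n))\<^sup>2" by simp
      then have "250000 * a\<^sup>2 \<le> nat \<lceil>250000 * (ln (real n))\<^sup>2\<rceil>" by linarith
      then have "measure_pmf.prob (rand_rpull V E {s} (nat \<lceil>250000 * (ln (real n))\<^sup>2\<rceil>)) {S. S \<noteq> V} \<le> 1 / (4 * real N)"
        by (rule random_upper_bound[OF s])
      \<comment> \<open>The factor 4 in \<open>random_upper_bound\<close> is there for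
        \<open>n < 4 * N\<close>.\<close>
      also have "\<dots> \<le> 1 / real n" using nN n by (intro divide_left_mono) auto
      also have "\<dots> = real n powr (- 1)" using n by (simp add: powr_minus_divide)
      finally show ?thesis .
    qed
    ultimately show ?thesis by blast
  qed
  show ?thesis
    by (rule exI[of _ "1 / 4"], rule exI[of _ 20], rule exI[of _ "1 / 48"], rule exI[of _ 250000],
        rule exI[of _ 1], rule exI[of _ 256]) (use main in simp)
qed

end
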